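(* Let $(F_4)^{\gamma}=\{\alpha\in F_4 \mid \gamma\alpha\gamma=\alpha\}$ and $(F_4)^{\gamma\sigma}=\{\alpha\in F_4\mid (\gamma\sigma)\alpha(\gamma\sigma)^{-1}=\alpha\}$. Then $$(F_4)^{\gamma}\cap (F_4)^{\gamma\sigma}\;\cong\;(Sp(1)\times Sp(1)\times Sp(2))/\mathbf{Z}_2,\qquad \mathbf{Z}_2=\{(1,1,E),(-1,-1,-E)\},$$ where $E$ is the identity matrix.
   Context: Let $\mathbf{H}$ be the quaternions and let $\mathfrak{C}=\mathbf{H}\oplus\mathbf{H}e_4$ be the division Cayley algebra with product $(m+ae_4)(n+be_4)=(mn-\overline{b}a)+(a\overline{n}+bm)e_4$. Let $\mathfrak{J}=\{X\in M(3,\mathfrak{C})\mid X^*=X\}$ be the exceptional Jordan algebra with product $X\circ Y=\frac12(XY+YX)$; write $$X=\begin{pmatrix}\xi_1&x_3&\overline{x}_2\\ \overline{x}_3&\xi_2&x_1\\ x_2&\overline{x}_1&\xi_3\end{pmatrix},\quad \xi_k\in\mathbf{R},\ x_k\in\mathfrak{C}.$$ $F_4=\{\alpha\in\mathrm{Iso}_{\mathbf R}(\mathfrak{J})\mid \alpha(X\circ Y)=\alpha X\circ\alpha Y\}$. The involutive elements $\gamma,\sigma\in F_4$ are: $\gamma$ acts entrywise by $\gamma(x+ye_4)=x-ye_4$ ($x,y\in\mathbf{H}$); $\sigma$ keeps $\xi_1,\xi_2,\xi_3,x_1$ and replaces $x_2,x_3$ by $-x_2,-x_3$. $Sp(n)=\{A\in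 M(n,\mathbf{H})\mid AA^*=E\}$. *)

theory Defs
  imports "HOL-Analysis.Analysis" "HOL-Algebra.Coset"
begin

section \<open>Quaternions\<close>

(* Quat a b c d is a + b i + c j + d k. *)
datatype quat = Quat (qre: real) (qi: real) (qj: real) (qk: real)

lemma quat_eq_iff: "p = q \<longleftrightarrow> qre p = qre q \<and> qi p = qi q \<and> qj p = qj q \<and> qk p = qk q"
  by (auto intro: quat.expand)

instantiation quat :: ring_1
begin

definition zero_quat :: quat where "0 = Quat 0 0 0 0"

definition one_quat :: quat where "1 = Quat 1 0 0 0"

definition plus_quat :: "quat \<Rightarrow> quat \<Rightarrow> quat" where
  "p + q = Quat (qre p + qre q) (qi p + qi q) (qj p + qj q) (qk p + qk q)"

definition minus_quat :: "quat \<Rightarrow> quat \<Rightarrow> quat" where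
  "p - q = Quat (qre p - qre q) (qi p - qi q) (qj p - qj q) (qk p - qk q)"

definition uminus_quat :: "quat \<Rightarrow> quat" where
  "- p = Quat (- qre p) (- qi p) (- qj p) (- qk p)"

definition times_quat :: "quat \<Rightarrow> quat \<Rightarrow> quat" where
  "p * q = Quat
     (qre p * qre q - qi p * qi q - qj p * qj q - qk p * qk q)
     (qre p * qi q + qi p * qre q + qj p * qk q - qk p * qj q)
     (qre p * qj q - qi p * qk q + qj p * qre q + qk p * qi q)
     (qre p * qk q + qi p * qj q - qj p * qi q + qk p * qre q)"

instance
  by standard
    (simp_all add: quat_eq_iff zero_quat_def one_quat_def plus_quat_def minus_quat_def
      uminus_quat_def times_quat_def algebra_simps)

end

instantiation quat :: real_inner
begin

definition scaleR_quat :: "real \<Rightarrow> quat \<Rightarrow> quat" where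
  "r *\<^sub>R p = Quat (r * qre p) (r * qi p) (r * qj p) (r * qk p)"

definition inner_quat :: "quat \<Rightarrow> quat \<Rightarrow> real" where
  "inner p q = qre p * qre q + qi p * qi q + qj p * qj q + qk p * qk q"

definition norm_quat :: "quat \<Rightarrow> real" where "norm (p::quat) = sqrt (inner p p)"

definition sgn_quat :: "quat \<Rightarrow> quat" where "sgn (p::quat) = inverse (norm p) *\<^sub>R p"

definition dist_quat :: "quat \<Rightarrow> quat \<Rightarrow> real" where "dist (p::quat) q = norm (p - q)"

definition uniformity_quat :: "(quat \<times> quat) filter" where
  "uniformity_quat = (INF e\<in>{0 <..}. principal {(x, y). dist x y < e})"

definition open_quat :: "quat set \<Rightarrow> bool" where
  "open_quat U \<longleftrightarrow> (\<forall>x\<in>U. eventually (\<lambda>(x', y). x' = x \<longrightarrow> y \<in> U) uniformity)"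

instance
proof
  fix p :: quat
  show "inner p p = 0 \<longleftrightarrow> p = 0"
    unfolding inner_quat_def quat_eq_iff zero_quat_def
    by (simp add: add_nonneg_eq_0_iff)
qed (simp_all add: quat_eq_iff plus_quat_def scaleR_quat_def inner_quat_def norm_quat_def
      sgn_quat_def dist_quat_def uniformity_quat_def open_quat_def algebra_simps)

end

definition qcnj :: "quat \<Rightarrow> quat" where
  "qcnj p = Quat (qre p) (- qi p) (- qj p) (- qk p)"

lemma qcnj_add: "qcnj (p + q) = qcnj p + qcnj q"
  and qcnj_diff: "qcnj (p - q) = qcnj p - qcnj q"
  and qcnj_minus: "qcnj (- p) = - qcnj p"
  and qcnj_zero: "qcnj 0 = 0"
  and qcnj_scaleR: "qcnj (r *\<^sub>R p) = r *\<^sub>R qcnj p"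
  and qcnj_mult: "qcnj (p * q) = qcnj q * qcnj p"
  and qcnj_qcnj: "qcnj (qcnj p) = p"
  by (simp_all add: quat_eq_iff qcnj_def zero_quat_def plus_quat_def minus_quat_def
      uminus_quat_def times_quat_def scaleR_quat_def algebra_simps)


section \<open>The division Cayley algebra\<close>

(* Cayley m a is m + a e_4. *)
datatype cayley = Cayley (cH: quat) (cE: quat)

lemma cayley_eq_iff: "x = y \<longleftrightarrow> cH x = cH y \<and> cE x = cE y"
  by (auto intro: cayley.expand)

instantiation cayley :: real_inner
begin

definition zero_cayley :: cayley where "0 = Cayley 0 0"

definition plus_cayley :: "cayley \<Rightarrow> cayley \<Rightarrow> cayley" where
  "x + y = Cayley (cH x + cH y) (cE x + cE y)"

definition minus_cayley :: "cayley \<Rightarrow> cayley \<Rightarrow> cayley" where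
  "x - y = Cayley (cH x - cH y) (cE x - cE y)"

definition uminus_cayley :: "cayley \<Rightarrow> cayley" where
  "- x = Cayley (- cH x) (- cE x)"

definition scaleR_cayley :: "real \<Rightarrow> cayley \<Rightarrow> cayley" where
  "r *\<^sub>R x = Cayley (r *\<^sub>R cH x) (r *\<^sub>R cE x)"

definition inner_cayley :: "cayley \<Rightarrow> cayley \<Rightarrow> real" where
  "inner x y = inner (cH x) (cH y) + inner (cE x) (cE y)"

definition norm_cayley :: "cayley \<Rightarrow> real" where "norm (x::cayley) = sqrt (inner x x)"

definition sgn_cayley :: "cayley \<Rightarrow> cayley" where "sgn (x::cayley) = inverse (norm x) *\<^sub>R x"

definition dist_cayley :: "cayley \<Rightarrow> cayley \<Rightarrow> real" where "dist (x::cayley) y = norm (x - y)"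

definition uniformity_cayley :: "(cayley \<times> cayley) filter" where
  "uniformity_cayley = (INF e\<in>{0 <..}. principal {(x, y). dist x y < e})"

definition open_cayley :: "cayley set \<Rightarrow> bool" where
  "open_cayley U \<longleftrightarrow> (\<forall>x\<in>U. eventually (\<lambda>(x', y). x' = x \<longrightarrow> y \<in> U) uniformity)"

instance
proof
  fix x :: cayley
  show "inner x x = 0 \<longleftrightarrow> x = 0"
    by (simp add: inner_cayley_def cayley_eq_iff zero_cayley_def add_nonneg_eq_0_iff)
next
  fix x y :: cayley
  show "inner x y = inner y x"
    by (simp add: inner_cayley_def inner_commute)
qed (simp_all add: cayley_eq_iff zero_cayley_def plus_cayley_def minus_cayley_def
      uminus_cayley_def scaleR_cayley_def inner_cayley_def norm_cayley_def
      sgn_cayley_def dist_cayley_def uniformity_cayley_def open_cayley_def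
      inner_add_left scaleR_add_left scaleR_add_right distrib_left)

end

instantiation cayley :: times
begin

definition times_cayley :: "cayley \<Rightarrow> cayley \<Rightarrow> cayley" where
  "x * y = Cayley (cH x * cH y - qcnj (cE y) * cE x) (cE x * qcnj (cH y) + cE y * cH x)"

instance ..

end

definition ccnj :: "cayley \<Rightarrow> cayley" where
  "ccnj x = Cayley (qcnj (cH x)) (- cE x)"

lemma ccnj_add: "ccnj (x + y) = ccnj x + ccnj y"
  and ccnj_diff: "ccnj (x - y) = ccnj x - ccnj y"
  and ccnj_minus: "ccnj (- x) = - ccnj x"
  and ccnj_zero: "ccnj 0 = 0"
  and ccnj_scaleR: "ccnj (r *\<^sub>R x) = r *\<^sub>R ccnj x"
  and ccnj_mult: "ccnj (x * y) = ccnj y * ccnj x"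
  by (simp_all add: cayley_eq_iff ccnj_def zero_cayley_def plus_cayley_def minus_cayley_def
      uminus_cayley_def times_cayley_def scaleR_cayley_def qcnj_add qcnj_diff qcnj_minus
      qcnj_zero qcnj_scaleR qcnj_mult qcnj_qcnj)

lemma ccnj_sum: "ccnj (sum f A) = (\<Sum>k\<in>A. ccnj (f k))"
  by (induction A rule: infinite_finite_induct) (simp_all add: ccnj_zero ccnj_add)

definition cgamma :: "cayley \<Rightarrow> cayley" where
  "cgamma x = Cayley (cH x) (- cE x)"

lemma cgamma_add: "cgamma (x + y) = cgamma x + cgamma y"
  and cgamma_zero: "cgamma 0 = 0"
  and cgamma_scaleR: "cgamma (r *\<^sub>R x) = r *\<^sub>R cgamma x"
  and cgamma_mult: "cgamma (x * y) = cgamma x * cgamma y"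
  and cgamma_ccnj: "cgamma (ccnj x) = ccnj (cgamma x)"
  and cgamma_cgamma: "cgamma (cgamma x) = x"
  by (simp_all add: cayley_eq_iff ccnj_def cgamma_def zero_cayley_def plus_cayley_def
      times_cayley_def scaleR_cayley_def qcnj_minus)

lemma cgamma_sum: "cgamma (sum f A) = (\<Sum>k\<in>A. cgamma (f k))"
  by (induction A rule: infinite_finite_induct) (simp_all add: cgamma_zero cgamma_add)


section \<open>The exceptional Jordan algebra\<close>

(* The library product ** needs an associative coefficient ring, so it does not apply here. *)
definition cmat_mult :: "cayley^3^3 \<Rightarrow> cayley^3^3 \<Rightarrow> cayley^3^3" where
  "cmat_mult X Y = (\<chi> i j. \<Sum>k\<in>UNIV. X $ i $ k * Y $ k $ j)"

definition cmat_adj :: "cayley^3^3 \<Rightarrow> cayley^3^3" where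
  "cmat_adj X = (\<chi> i j. ccnj (X $ j $ i))"

lemma cmat_adj_add: "cmat_adj (X + Y) = cmat_adj X + cmat_adj Y"
  and cmat_adj_diff: "cmat_adj (X - Y) = cmat_adj X - cmat_adj Y"
  and cmat_adj_minus: "cmat_adj (- X) = - cmat_adj X"
  and cmat_adj_zero: "cmat_adj 0 = 0"
  and cmat_adj_scaleR: "cmat_adj (r *\<^sub>R X) = r *\<^sub>R cmat_adj X"
  and cmat_adj_mult: "cmat_adj (cmat_mult X Y) = cmat_mult (cmat_adj Y) (cmat_adj X)"
  by (simp_all add: cmat_adj_def cmat_mult_def vec_eq_iff ccnj_add ccnj_diff ccnj_minus
      ccnj_zero ccnj_scaleR ccnj_sum ccnj_mult)

typedef jordan = "{X :: cayley^3^3. cmat_adj X = X}"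
  morphisms jmat Jordan
  by (rule exI[of _ 0]) (simp add: cmat_adj_zero)

setup_lifting type_definition_jordan

(* Linear structure, inner product and hence topology are those induced from M(3, C). *)
instantiation jordan :: real_inner
begin

lift_definition zero_jordan :: jordan is 0
  by (simp add: cmat_adj_zero)

lift_definition plus_jordan :: "jordan \<Rightarrow> jordan \<Rightarrow> jordan" is "(+)"
  by (simp add: cmat_adj_add)

lift_definition minus_jordan :: "jordan \<Rightarrow> jordan \<Rightarrow> jordan" is "(-)"
  by (simp add: cmat_adj_diff)

lift_definition uminus_jordan :: "jordan \<Rightarrow> jordan" is uminus
  by (simp add: cmat_adj_minus)

lift_definition scaleR_jordan :: "real \<Rightarrow> jordan \<Rightarrow> jordan" is scaleR
  by (simp add: cmat_adj_scaleR)

lift_definition inner_jordan :: "jordan \<Rightarrow> jordan \<Rightarrow> real" is inner .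

definition norm_jordan :: "jordan \<Rightarrow> real" where "norm (X::jordan) = sqrt (inner X X)"

definition sgn_jordan :: "jordan \<Rightarrow> jordan" where "sgn (X::jordan) = inverse (norm X) *\<^sub>R X"

definition dist_jordan :: "jordan \<Rightarrow> jordan \<Rightarrow> real" where "dist (X::jordan) Y = norm (X - Y)"

definition uniformity_jordan :: "(jordan \<times> jordan) filter" where
  "uniformity_jordan = (INF e\<in>{0 <..}. principal {(x, y). dist x y < e})"

definition open_jordan :: "jordan set \<Rightarrow> bool" where
  "open_jordan U \<longleftrightarrow> (\<forall>x\<in>U. eventually (\<lambda>(x', y). x' = x \<longrightarrow> y \<in> U) uniformity)"

instance
proof
  fix X Y Z :: jordan and r s :: real
  show "X + Y + Z = X + (Y + Z)" by transfer (rule add.assoc)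
  show "X + Y = Y + X" by transfer (rule add.commute)
  show "0 + X = X" by transfer (rule add_0_left)
  show "- X + X = 0" by transfer (rule left_minus)
  show "X - Y = X + - Y" by transfer (rule diff_conv_add_uminus)
  show "r *\<^sub>R (X + Y) = r *\<^sub>R X + r *\<^sub>R Y" by transfer (rule scaleR_add_right)
  show "(r + s) *\<^sub>R X = r *\<^sub>R X + s *\<^sub>R X" by transfer (rule scaleR_add_left)
  show "r *\<^sub>R s *\<^sub>R X = (r * s) *\<^sub>R X" by transfer (rule scaleR_scaleR)
  show "1 *\<^sub>R X = X" by transfer (rule scaleR_one)
  show "inner X Y = inner Y X" by transfer (rule inner_commute)
  show "inner (X + Y) Z = inner X Z + inner Y Z" by transfer (rule inner_add_left)
  show "inner (r *\<^sub>R X) Y = r * inner X Y" by transfer (rule inner_scaleR_left)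
  show "0 \<le> inner X X" by transfer (rule inner_ge_zero)
  show "inner X X = 0 \<longleftrightarrow> X = 0" by transfer (rule inner_eq_zero_iff)
qed (simp_all only: norm_jordan_def sgn_jordan_def dist_jordan_def uniformity_jordan_def
      open_jordan_def)

end

lift_definition jordan_mult :: "jordan \<Rightarrow> jordan \<Rightarrow> jordan"
  is "\<lambda>X Y. (1 / 2) *\<^sub>R (cmat_mult X Y + cmat_mult Y X)"
  by (simp add: cmat_adj_scaleR cmat_adj_add cmat_adj_mult add.commute)


section \<open>The group F4 and its involutions\<close>

(* As a set of functions into the normed space jordan, F4 carries the topology of pointwise
   convergence; on linear maps of a finite-dimensional space it is the usual topology. *)
definition F4 :: "(jordan \<Rightarrow> jordan) set" where
  "F4 = {\<alpha>. linear \<alpha> \<and> bij \<alpha> \<and>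
             (\<forall>X Y. \<alpha> (jordan_mult X Y) = jordan_mult (\<alpha> X) (\<alpha> Y))}"

definition F4_group :: "(jordan \<Rightarrow> jordan) monoid" where
  "F4_group = \<lparr>carrier = F4, monoid.mult = (\<circ>), one = id\<rparr>"

lift_definition gamma :: "jordan \<Rightarrow> jordan"
  is "\<lambda>X. \<chi> i j. cgamma (X $ i $ j)"
  by (simp add: cmat_adj_def vec_eq_iff flip: cgamma_ccnj)

(* In the layout ((xi_1, x_3, x_2^* ), (x_3^*, xi_2, x_1), (x_2, x_1^*, xi_3)) the entries x_2, x_3
   and their conjugates are those with exactly one index equal to 1. *)
lift_definition sigma :: "jordan \<Rightarrow> jordan"
  is "\<lambda>X. \<chi> i j. if (i = 1) = (j = 1) then X $ i $ j else - (X $ i $ j)"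
  by (auto simp: cmat_adj_def vec_eq_iff ccnj_minus)

lemma gamma_gamma: "gamma \<circ> gamma = id"
  by (rule ext, simp, transfer) (simp add: cgamma_cgamma vec_eq_iff)

lemma sigma_sigma: "sigma \<circ> sigma = id"
  by (rule ext, simp, transfer) (simp add: vec_eq_iff)

lemma gamma_in_F4: "gamma \<in> F4"
proof -
  have "linear gamma"
    by (rule linearI; transfer; simp add: vec_eq_iff cgamma_add cgamma_scaleR)
  moreover have "bij gamma"
    using gamma_gamma gamma_gamma by (rule o_bij)
  moreover have "gamma (jordan_mult X Y) = jordan_mult (gamma X) (gamma Y)" for X Y
    by transfer (simp add: vec_eq_iff cmat_mult_def cgamma_add cgamma_scaleR cgamma_sum cgamma_mult)
  ultimately show ?thesis
    by (simp add: F4_def)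
qed

lemma cayley_mult_minus: "(- x) * y = - (x * y)" "x * (- y) = - (x * y)" for x y :: cayley
  by (simp_all add: cayley_eq_iff times_cayley_def uminus_cayley_def qcnj_minus)

lemma sigma_mult: "sigma (jordan_mult X Y) = jordan_mult (sigma X) (sigma Y)"
proof transfer
  fix X Y :: "cayley^3^3"
  define S :: "cayley^3^3 \<Rightarrow> cayley^3^3"
    where "S Z = (\<chi> i j. if (i = 1) = (j = 1) then Z $ i $ j else - (Z $ i $ j))" for Z
  have mult: "S (cmat_mult U V) = cmat_mult (S U) (S V)" for U V
  proof -
    have "S U $ i $ k * S V $ k $ j
        = (if (i = 1) = (j = 1) then U $ i $ k * V $ k $ j else - (U $ i $ k * V $ k $ j))"
      for i j k
      by (cases "i = 1"; cases "j = 1"; cases "k = 1")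
        (simp_all add: S_def cayley_mult_minus)
    then show ?thesis
      by (auto simp: vec_eq_iff cmat_mult_def S_def[of "\<chi> i j. \<Sum>k\<in>UNIV. U $ i $ k * V $ k $ j"]
          sum_negf)
  qed
  have "S (c *\<^sub>R (U + V)) = c *\<^sub>R (S U + S V)" for c U V
    by (simp add: S_def vec_eq_iff scaleR_add_right scaleR_diff_right)
  then have "S ((1 / 2) *\<^sub>R (cmat_mult X Y + cmat_mult Y X)) =
      (1 / 2) *\<^sub>R (cmat_mult (S X) (S Y) + cmat_mult (S Y) (S X))"
    by (simp only: mult)
  then show "(\<chi> i j. if (i = 1) = (j = 1)
        then ((1 / 2) *\<^sub>R (cmat_mult X Y + cmat_mult Y X)) $ i $ j
        else - (((1 / 2) *\<^sub>R (cmat_mult X Y + cmat_mult Y X)) $ i $ j)) =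
      (1 / 2) *\<^sub>R
       (cmat_mult (\<chi> i j. if (i = 1) = (j = 1) then X $ i $ j else - (X $ i $ j))
          (\<chi> i j. if (i = 1) = (j = 1) then Y $ i $ j else - (Y $ i $ j)) +
        cmat_mult (\<chi> i j. if (i = 1) = (j = 1) then Y $ i $ j else - (Y $ i $ j))
          (\<chi> i j. if (i = 1) = (j = 1) then X $ i $ j else - (X $ i $ j)))"
    by (simp only: S_def)
qed

lemma sigma_in_F4: "sigma \<in> F4"
proof -
  have "linear sigma"
    by (rule linearI; transfer; simp add: vec_eq_iff)
  moreover have "bij sigma"
    using sigma_sigma sigma_sigma by (rule o_bij)
  ultimately show ?thesis
    by (simp add: F4_def sigma_mult)
qed

definition F4_gamma :: "(jordan \<Rightarrow> jordan) set" where
  "F4_gamma = {\<alpha> \<in> F4. gamma \<circ> \<alpha> \<circ> gamma = \<alpha>}"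

(* inv_into UNIV is the inverse function; HOL-Algebra reuses its short notation inv. *)
definition F4_gamma_sigma :: "(jordan \<Rightarrow> jordan) set" where
  "F4_gamma_sigma = {\<alpha> \<in> F4. (gamma \<circ> sigma) \<circ> \<alpha> \<circ> inv_into UNIV (gamma \<circ> sigma) = \<alpha>}"


section \<open>Symplectic groups\<close>

definition qmat_adj :: "quat^'n^'m \<Rightarrow> quat^'m^'n" where
  "qmat_adj A = (\<chi> i j. qcnj (A $ j $ i))"

definition Sp :: "(quat^'n^'n) set" where
  "Sp = {A. A ** qmat_adj A = mat 1}"

definition Sp_group :: "(quat^'n^'n) monoid" where
  "Sp_group = \<lparr>carrier = Sp, monoid.mult = (**), one = mat 1\<rparr>"

abbreviation Sp1_Sp1_Sp2 :: "((quat^1^1) \<times> (quat^1^1) \<times> (quat^2^2)) monoid" where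
  "Sp1_Sp1_Sp2 \<equiv> Sp_group \<times>\<times> Sp_group \<times>\<times> Sp_group"

definition Z2 :: "((quat^1^1) \<times> (quat^1^1) \<times> (quat^2^2)) set" where
  "Z2 = {(mat 1, mat 1, mat 1), (- mat 1, - mat 1, - mat 1)}"


section \<open>Isomorphism of topological groups\<close>

(* For a partition P of the points of T, a union of classes is the preimage of a set of
   classes under the canonical projection; this is therefore the quotient topology on P. *)
definition partition_topology :: "'a topology \<Rightarrow> 'a set set \<Rightarrow> 'a set topology" where
  "partition_topology T P = topology (\<lambda>\<U>. \<U> \<subseteq> P \<and> openin T (\<Union>\<U>))"

lemma openin_partition_topology:
  assumes "disjoint P"
  shows "openin (partition_topology T P) \<U> \<longleftrightarrow> \<U> \<subseteq> P \<and> openin T (\<Union>\<U>)"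
proof -
  have "istopology (\<lambda>\<U>. \<U> \<subseteq> P \<and> openin T (\<Union>\<U>))"
    unfolding istopology_def
  proof (intro conjI allI impI)
    fix \<U> \<V> assume U: "\<U> \<subseteq> P \<and> openin T (\<Union>\<U>)" and V: "\<V> \<subseteq> P \<and> openin T (\<Union>\<V>)"
    then show "\<U> \<inter> \<V> \<subseteq> P" by blast
    have "\<Union>(\<U> \<inter> \<V>) = \<Union>\<U> \<inter> \<Union>\<V>"
    proof
      show "\<Union>\<U> \<inter> \<Union>\<V> \<subseteq> \<Union>(\<U> \<inter> \<V>)"
      proof
        fix x assume "x \<in> \<Union>\<U> \<inter> \<Union>\<V>"
        then obtain A B where AB: "A \<in> \<U>" "x \<in> A" "B \<in> \<V>" "x \<in> B" by blast
        then have "A = B"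
          using disjointD[OF assms, of A B] U V by blast
        with AB show "x \<in> \<Union>(\<U> \<inter> \<V>)" by blast
      qed
    qed blast
    with U V show "openin T (\<Union>(\<U> \<inter> \<V>))" by (simp add: openin_Int)
  next
    fix \<K> assume K: "\<forall>\<U>\<in>\<K>. \<U> \<subseteq> P \<and> openin T (\<Union>\<U>)"
    then show "\<Union>\<K> \<subseteq> P" by blast
    have "openin T (\<Union>\<U>\<in>\<K>. \<Union>\<U>)"
      using K by (intro openin_Union) blast
    moreover have "(\<Union>\<U>\<in>\<K>. \<Union>\<U>) = \<Union>(\<Union>\<K>)" by blast
    ultimately show "openin T (\<Union>(\<Union>\<K>))" by simp
  qed
  then show ?thesis
    by (simp add: partition_topology_def topology_inverse')
qed

definition topological_group_iso ::
  "('a, 'c) monoid_scheme \<Rightarrow> 'a topology \<Rightarrow> ('b, 'd) monoid_scheme \<Rightarrow> 'b topology \<Rightarrow> bool" where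
  "topological_group_iso G S H T \<longleftrightarrow> (\<exists>f. f \<in> iso G H \<and> homeomorphic_map S T f)"

end

theory Submission
  imports Defs
begin

text \<open>Write an element of the Jordan algebra as \<open>M + a\<close> with \<open>M\<close> a Hermitian quaternionic matrix and \<open>a\<close>
  a quaternionic row, the coefficients of \<open>e\<^sub>4\<close>. For \<open>P \<in> Sp(1)\<close> and \<open>A \<in> Sp(3)\<close> the map
  \<open>M + a \<mapsto> A M A\<^sup>* + P a A\<^sup>*\<close> is an automorphism commuting with \<open>\<gamma>\<close>. Conversely, such an
  automorphism preserves both summands. The product of \<open>M\<close> and \<open>a\<close> is half of \<open>a (tr M - M)\<close>, so the
  action \<open>g\<close> on rows normalizes right multiplication by Hermitian matrices, hence also its commutant,
  left multiplication by quaternions. By Skolem-Noether \<open>g a = P a C\<close>; then \<open>C C\<^sup>*\<close> commutes with all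
  Hermitian matrices, so it is a real scalar, which invariance of the trace shows to be 1. As \<open>\<sigma>\<close>
  is the action of \<open>P = -1\<close> and \<open>A = diag(-1, 1, 1)\<close>, commuting with \<open>\<sigma>\<close> means
  \<open>A \<in> Sp(1) \<times> Sp(2)\<close>. The map is a continuous surjection from a compact to a Hausdorff space, hence
  a quotient map.\<close>

section \<open>Quaternions and quaternionic matrices\<close>

lemmas quat_ops = quat_eq_iff zero_quat_def one_quat_def plus_quat_def minus_quat_def
  uminus_quat_def times_quat_def scaleR_quat_def qcnj_def

lemma euler_four_square: "(a * a' - b * b' - c * c' - d * d')\<^sup>2 + (a * b' + b * a' + c * d' - d * c')\<^sup>2
   + (a * c' - b * d' + c * a' + d * b')\<^sup>2 + (a * d' + b * c' - c * b' + d * a')\<^sup>2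
   = (a\<^sup>2 + b\<^sup>2 + c\<^sup>2 + d\<^sup>2) * (a'\<^sup>2 + b'\<^sup>2 + c'\<^sup>2 + d'\<^sup>2)" for a b c d :: real
  by algebra

lemma inner_mult_quat: "inner (a * b) (a * b) = inner a a * inner b b" for a b :: quat
  using euler_four_square[of "qre a" "qre b" "qi a" "qi b" "qj a" "qj b" "qk a" "qk b"]
  by (simp only: inner_quat_def times_quat_def quat.sel power2_eq_square)

text \<open>Makes quaternion multiplication continuous, for \<open>compact_Sp\<close> and
  \<open>continuous_on_block_act\<close>. The norm is multiplicative by Euler's identity.\<close>

instance quat :: real_normed_algebra_1
proof
  fix a b :: quat and r :: real
  show "r *\<^sub>R a * b = r *\<^sub>R (a * b)" "a * r *\<^sub>R b = r *\<^sub>R (a * b)"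
    by (simp_all add: quat_ops algebra_simps)
  show "norm (a * b) \<le> norm a * norm b"
    by (simp only: norm_quat_def inner_mult_quat real_sqrt_mult order_refl)
  show "norm (1::quat) = 1"
    by (simp add: norm_quat_def inner_quat_def one_quat_def)
qed

text \<open>Finite dimension gives Heine-Borel in \<open>compact_Sp\<close> and turns injective
  linear maps into surjective ones in \<open>Sp_adj_left\<close>.\<close>

instantiation quat :: euclidean_space
begin

definition Basis_quat :: "quat set" where
  "Basis_quat = {Quat 1 0 0 0, Quat 0 1 0 0, Quat 0 0 1 0, Quat 0 0 0 1}"

instance
proof
  fix u v x :: quat
  show "(Basis :: quat set) \<noteq> {}"
    unfolding Basis_quat_def by (rule insert_not_empty)
  show "finite (Basis :: quat set)"
    unfolding Basis_quat_def by (intro finite.intros)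
  show "inner u v = (if u = v then 1 else 0)" if "u \<in> Basis" "v \<in> Basis"
    using that unfolding Basis_quat_def inner_quat_def quat_eq_iff
    by (elim insertE emptyE; simp only: quat.sel; simp)
  show "(\<forall>u\<in>Basis. inner x u = 0) \<longleftrightarrow> x = 0"
    unfolding Basis_quat_def inner_quat_def quat_eq_iff zero_quat_def
    by (simp only: ball_simps quat.sel; simp)
qed

end

lemma qcnj_one: "qcnj 1 = 1"
  by (simp add: quat_ops)

lemma qcnj_sum: "qcnj (sum f A) = (\<Sum>k\<in>A. qcnj (f k))"
  by (induction A rule: infinite_finite_induct) (simp_all add: qcnj_zero qcnj_add)

lemma linear_qre: "linear qre"
  by (rule linearI) (simp_all add: quat_ops)

lemma linear_qcnj: "linear qcnj"
  by (rule linearI) (simp_all add: qcnj_add qcnj_scaleR)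

lemma qre_mult_commute: "qre (p * q) = qre (q * p)"
  by (simp add: quat_ops)

lemma inner_quat_eq: "inner p q = qre (p * qcnj q)"
  by (simp add: inner_quat_def quat_ops)

lemma mult_qcnj: "p * qcnj p = of_real (inner p p)"
  by (simp add: of_real_def inner_quat_def quat_ops)

lemma qcnj_mult_self: "qcnj p * p = of_real (inner p p)"
  by (simp add: of_real_def inner_quat_def quat_ops)

lemma quat_central_iff: "(\<forall>h. q * h = h * q) \<longleftrightarrow> q = of_real (qre q)"
proof
  assume "\<forall>h. q * h = h * q"
  \<comment> \<open>Commuting with i and j alone already kills all three imaginary parts.\<close>
  then have "q * Quat 0 1 0 0 = Quat 0 1 0 0 * q" "q * Quat 0 0 1 0 = Quat 0 0 1 0 * q"
    by blast+
  then show "q = of_real (qre q)"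
    by (simp add: quat_ops of_real_def)
next
  assume "q = of_real (qre q)"
  moreover have "of_real r * h = h * of_real r" for r and h :: quat
    by (simp add: of_real_def)
  ultimately show "\<forall>h. q * h = h * q"
    by metis
qed

text \<open>Averaging: \<open>p = \<Sum>e. \<theta> e * x * e\<inverse>\<close> over the units \<open>e = 1, i, j, k\<close> intertwines, and
  \<open>\<Sum>x. p x * x\<inverse>\<close> over the same units is 4, so some choice of \<open>x\<close> gives \<open>p \<noteq> 0\<close>.\<close>
lemma skolem_noether_quat:
  fixes \<theta> :: "quat \<Rightarrow> quat"
  assumes lin: "linear \<theta>" and one: "\<theta> 1 = 1" and mult: "\<And>x y. \<theta> (x * y) = \<theta> x * \<theta> y"
  obtains p where "norm p = 1" "\<And>h. \<theta> h = p * h * qcnj p"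
proof -
  define i j k where ijk: "i = Quat 0 1 0 0" "j = Quat 0 0 1 0" "k = Quat 0 0 0 1"
  have rel: "i * i = -1" "j * j = -1" "k * k = -1" "i * j = k" "j * i = -k" "j * k = i"
    "k * j = -i" "k * i = j" "i * k = -j"
    by (simp_all add: ijk quat_ops)
  have th: "\<theta> i * \<theta> i = -1" "\<theta> j * \<theta> j = -1" "\<theta> k * \<theta> k = -1" "\<theta> i * \<theta> j = \<theta> k" "\<theta> j * \<theta> i = - \<theta> k"
    "\<theta> j * \<theta> k = \<theta> i" "\<theta> k * \<theta> j = - \<theta> i" "\<theta> k * \<theta> i = \<theta> j" "\<theta> i * \<theta> k = - \<theta> j"
    by (simp_all add: rel one linear_neg[OF lin] flip: mult)
  \<comment> \<open>The minus signs are the inverses of the imaginary units.\<close>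
  define P where "P x = x - \<theta> i * x * i - \<theta> j * x * j - \<theta> k * x * k" for x
  have Pi: "\<theta> i * P x = P x * i" for x
  proof -
    have "\<theta> i * P x = \<theta> i * x - (\<theta> i * \<theta> i) * x * i - (\<theta> i * \<theta> j) * x * j - (\<theta> i * \<theta> k) * x * k"
      by (simp add: P_def right_diff_distrib mult.assoc)
    also have "\<dots> = P x * i"
      by (simp add: P_def left_diff_distrib mult.assoc rel th)
    finally show ?thesis .
  qed
  have Pj: "\<theta> j * P x = P x * j" for x
  proof -
    have "\<theta> j * P x = \<theta> j * x - (\<theta> j * \<theta> i) * x * i - (\<theta> j * \<theta> j) * x * j - (\<theta> j * \<theta> k) * x * k"
      by (simp add: P_def right_diff_distrib mult.assoc)
    also have "\<dots> = P x * j"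
      by (simp add: P_def left_diff_distrib mult.assoc rel th)
    finally show ?thesis .
  qed
  have Pk: "\<theta> k * P x = P x * k" for x
    by (metis Pi Pj mult.assoc rel(4) th(4))
  have inter: "\<theta> h * P x = P x * h" for h x
  proof -
    have h: "h = qre h *\<^sub>R 1 + qi h *\<^sub>R i + qj h *\<^sub>R j + qk h *\<^sub>R k"
      by (simp add: ijk quat_ops)
    have "\<theta> h = qre h *\<^sub>R 1 + qi h *\<^sub>R \<theta> i + qj h *\<^sub>R \<theta> j + qk h *\<^sub>R \<theta> k"
      by (subst h) (simp add: linear_add[OF lin] linear_scale[OF lin] one)
    then have "\<theta> h * P x = qre h *\<^sub>R P x + qi h *\<^sub>R (P x * i) + qj h *\<^sub>R (P x * j) + qk h *\<^sub>R (P x * k)"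
      by (simp add: distrib_right Pi Pj Pk)
    also have "\<dots> = P x * (qre h *\<^sub>R 1 + qi h *\<^sub>R i + qj h *\<^sub>R j + qk h *\<^sub>R k)"
      by (simp add: distrib_left)
    finally show ?thesis
      using h by simp
  qed
  \<comment> \<open>The unit 1 contributes 4. An imaginary unit e contributes a multiple of
    \<open>\<theta> e\<close> by the sum of x e x^-1 over the four units x, which vanishes.\<close>
  have "P 1 - P i * i - P j * j - P k * k = 4"
    by (simp add: P_def left_diff_distrib distrib_right mult.assoc rel)
  then have "\<exists>x. P x \<noteq> 0"
    by (metis diff_zero mult_zero_left zero_neq_numeral)
  then obtain x where x: "P x \<noteq> 0" by blast
  define p where "p = P x /\<^sub>R norm (P x)"
  have norm: "norm p = 1"
    using x by (simp add: p_def)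
  have "\<theta> h = p * h * qcnj p" for h
  proof -
    have "\<theta> h * p = p * h"
      by (simp add: p_def inter)
    then have "p * h * qcnj p = \<theta> h * (p * qcnj p)"
      by (simp flip: mult.assoc)
    also have "p * qcnj p = 1"
      using norm by (simp add: mult_qcnj norm_eq_1)
    finally show ?thesis by simp
  qed
  with norm that show ?thesis by blast
qed

section \<open>Matrices over the quaternions, the real trace and Sp(n)\<close>

lemmas matrix_entry = vec_eq_iff matrix_matrix_mult_def

lemma matrix_add_rdistrib: "(A + B) ** C = A ** C + B ** (C :: 'a::semiring_1^'n^'m)"
  by (simp add: matrix_entry distrib_right sum.distrib)

lemma matrix_diff_ldistrib: "A ** (B - C) = A ** B - A ** (C :: 'a::ring_1^'n^'m)"
  by (simp add: matrix_entry right_diff_distrib sum_subtractf)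

lemma matrix_diff_rdistrib: "(A - B) ** C = A ** C - B ** (C :: 'a::ring_1^'n^'m)"
  by (simp add: matrix_entry left_diff_distrib sum_subtractf)

lemma matrix_minus_left: "(- A) ** C = - (A ** (C :: 'a::ring_1^'n^'m))"
  by (simp add: matrix_entry sum_negf)

lemma matrix_minus_right: "A ** (- C) = - (A ** (C :: 'a::ring_1^'n^'m))"
  by (simp add: matrix_entry sum_negf)

lemma matrix_zero_left: "0 ** C = (0 :: 'a::ring_1^'n^'m)"
  by (simp add: matrix_entry)

lemma matrix_zero_right: "C ** 0 = (0 :: 'a::ring_1^'n^'m)"
  by (simp add: matrix_entry)

lemma matrix_scaleR_left: "(r *\<^sub>R A) ** B = r *\<^sub>R (A ** B)"
  for A :: "'a::real_algebra_1^'m^'n"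
  by (simp add: scalar_matrix_assoc)

lemmas matrix_linear = matrix_add_ldistrib matrix_add_rdistrib matrix_diff_ldistrib
  matrix_diff_rdistrib matrix_minus_left matrix_minus_right matrix_zero_left matrix_zero_right
  matrix_scaleR_left matrix_scalar_ac

lemma qmat_adj_add: "qmat_adj (A + B) = qmat_adj A + qmat_adj B"
  and qmat_adj_diff: "qmat_adj (A - B) = qmat_adj A - qmat_adj B"
  and qmat_adj_minus: "qmat_adj (- A) = - qmat_adj A"
  and qmat_adj_zero: "qmat_adj 0 = 0"
  and qmat_adj_scaleR: "qmat_adj (r *\<^sub>R A) = r *\<^sub>R qmat_adj A"
  and qmat_adj_adj: "qmat_adj (qmat_adj A) = A"
  by (simp_all add: qmat_adj_def vec_eq_iff qcnj_add qcnj_diff qcnj_minus qcnj_zero qcnj_scaleR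
      qcnj_qcnj)

lemma qmat_adj_mult: "qmat_adj (A ** B) = qmat_adj B ** qmat_adj A"
  by (simp add: qmat_adj_def matrix_entry qcnj_sum qcnj_mult)

lemma qmat_adj_one: "qmat_adj (mat 1) = mat 1"
  by (auto simp add: qmat_adj_def mat_def vec_eq_iff qcnj_one qcnj_zero)

lemmas qmat_adj_linear = qmat_adj_add qmat_adj_diff qmat_adj_minus qmat_adj_zero qmat_adj_scaleR
  qmat_adj_one

text \<open>Taking real parts makes the trace cyclic over noncommuting entries
  (\<open>rtr_commute\<close>). Hermitian matrices have real diagonals, so for them this is the full
  trace.\<close>

definition rtr :: "quat^'n^'n \<Rightarrow> real" where
  "rtr A = (\<Sum>i\<in>UNIV. qre (A $ i $ i))"

lemma linear_rtr: "linear rtr"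
  by (rule linearI)
    (simp_all add: rtr_def linear_add[OF linear_qre] linear_scale[OF linear_qre] sum.distrib
      sum_distrib_left)

lemma rtr_commute: "rtr (A ** B) = rtr (B ** A)"
  by (simp add: rtr_def matrix_entry linear_sum[OF linear_qre] qre_mult_commute[of "A $ _ $ _"])
    (rule sum.swap)

lemma inner_eq_rtr: "inner A B = rtr (A ** qmat_adj B)"
  by (simp add: rtr_def inner_vec_def matrix_entry linear_sum[OF linear_qre] inner_quat_eq
      qmat_adj_def)

text \<open>Right multiplication by \<open>A\<close> is real linear and has the left inverse given
  by right multiplication by \<open>qmat_adj A\<close>, so by finite dimension it is onto. Hence
  \<open>A\<close> has a left inverse, which must agree with the right inverse.\<close>

lemma Sp_adj_left:
  assumes "A \<in> Sp" shows "qmat_adj A ** A = mat 1"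
proof -
  have A: "A ** qmat_adj A = mat 1"
    using assms by (simp add: Sp_def)
  have lin: "linear (\<lambda>X. X ** A)"
    by (rule linearI) (simp_all add: matrix_linear)
  moreover have "inj (\<lambda>X. X ** A)"
    by (rule inj_on_inverseI[where g = "\<lambda>X. X ** qmat_adj A"])
      (simp add: A flip: matrix_mul_assoc)
  ultimately have "surj (\<lambda>X. X ** A)"
    by (rule linear_injective_imp_surjective) simp
  then obtain Y where Y: "Y ** A = mat 1"
    by (metis surjD)
  then have "Y = qmat_adj A"
    by (metis A matrix_mul_assoc matrix_mul_lid matrix_mul_rid)
  with Y show ?thesis by simp
qed

lemma Sp_one: "mat 1 \<in> Sp"
  by (simp add: Sp_def qmat_adj_one)

lemma Sp_mult: "A \<in> Sp \<Longrightarrow> B \<in> Sp \<Longrightarrow> A ** B \<in> Sp"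
  by (simp add: Sp_def qmat_adj_mult) (metis matrix_mul_assoc matrix_mul_rid)

lemma Sp_adj: "A \<in> Sp \<Longrightarrow> qmat_adj A \<in> Sp"
  using Sp_adj_left by (simp add: Sp_def qmat_adj_adj)

lemma Sp_minus: "A \<in> Sp \<Longrightarrow> - A \<in> Sp"
  by (simp add: Sp_def qmat_adj_linear matrix_linear)

lemma group_Sp: "group Sp_group"
proof (rule groupI)
  fix A :: "quat^'n^'n" assume "A \<in> carrier Sp_group"
  then show "\<exists>B\<in>carrier Sp_group. B \<otimes>\<^bsub>Sp_group\<^esub> A = \<one>\<^bsub>Sp_group\<^esub>"
    by (auto simp: Sp_group_def Sp_adj_left intro!: bexI[of _ "qmat_adj A"] Sp_adj)
qed (auto simp: Sp_group_def Sp_one Sp_mult matrix_mul_assoc)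

text \<open>Closed as a fibre of a continuous map; bounded because the squared norm of
  \<open>A\<close> is the trace of \<open>A ** qmat_adj A\<close>, the size of the matrix.\<close>

lemma compact_Sp: "compact (Sp :: (quat^'n^'n) set)"
proof -
  have cont: "continuous_on UNIV (\<lambda>A :: quat^'n^'n. A ** qmat_adj A)"
    unfolding qmat_adj_def matrix_matrix_mult_def
    by (intro continuous_intros linear_continuous_on_compose[OF _ linear_qcnj])
  have "Sp = (\<lambda>A :: quat^'n^'n. A ** qmat_adj A) -` {mat 1}"
    by (auto simp: Sp_def)
  then have "closed (Sp :: (quat^'n^'n) set)"
    using cont by (metis closed_singleton closed_vimage)
  moreover have "norm A \<le> sqrt CARD('n)" if "A \<in> Sp" for A :: "quat^'n^'n"
    using that by (simp add: norm_eq_sqrt_inner inner_eq_rtr Sp_def) (simp add: rtr_def mat_def one_quat_def)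
  ultimately show ?thesis
    unfolding compact_eq_bounded_closed by (auto intro: boundedI)
qed

section \<open>The Jordan algebra as Hermitian matrices and rows\<close>

text \<open>An element of the Jordan algebra is a Hermitian quaternionic matrix \<open>M\<close> together with a row
  \<open>a = (a\<^sub>1, a\<^sub>2, a\<^sub>3)\<close>, where the off-diagonal entries are \<open>x\<^sub>k = m\<^sub>k + a\<^sub>k e\<^sub>4\<close>. Rows are 1-by-3 matrices,
  so that both parts live in an associative matrix calculus.\<close>
definition mpart :: "jordan \<Rightarrow> quat^3^3" where
  "mpart X = (\<chi> i j. cH (jmat X $ i $ j))"

definition vpart :: "jordan \<Rightarrow> quat^3^1" where
  "vpart X = (\<chi> _ k. if k = 1 then cE (jmat X $ 2 $ 3) else
    if k = 2 then cE (jmat X $ 3 $ 1) else cE (jmat X $ 1 $ 2))"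

text \<open>Cayley conjugation negates the \<open>e_4\<close> coefficient, so in a Hermitian matrix
  these coefficients form an antisymmetric matrix. Its free entries sit at the cyclic positions
  (2,3), (3,1), (1,2), as for a cross product.\<close>

definition skew_part :: "quat^3^1 \<Rightarrow> quat^3^3" where
  "skew_part a = (\<chi> i j.
    if i = 1 then if j = 1 then 0 else if j = 2 then a$1$3 else - (a$1$2)
    else if i = 2 then if j = 1 then - (a$1$3) else if j = 2 then 0 else a$1$1
    else if j = 1 then a$1$2 else if j = 2 then - (a$1$1) else 0)"

text \<open>Meaningful only for Hermitian \<open>M\<close>; otherwise the argument lies outside the
  set defining the type and \<open>Jordan\<close> is unspecified.\<close>

definition jordan_of :: "quat^3^3 \<Rightarrow> quat^3^1 \<Rightarrow> jordan" where
  "jordan_of M a = Jordan (\<chi> i j. Cayley (M $ i $ j) (skew_part a $ i $ j))"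

lemma three_cases: "(1::3) \<noteq> 2" "(1::3) \<noteq> 3" "(2::3) \<noteq> 3" "(2::3) \<noteq> 1" "(3::3) \<noteq> 1" "(3::3) \<noteq> 2"
  by simp_all

lemmas cayley_ops = cayley_eq_iff zero_cayley_def plus_cayley_def minus_cayley_def
  uminus_cayley_def times_cayley_def scaleR_cayley_def ccnj_def

lemma jmat_adj: "jmat X $ i $ j = ccnj (jmat X $ j $ i)"
  using jmat[of X] by (simp add: cmat_adj_def vec_eq_iff)

lemma cE_jmat: "cE (jmat X $ i $ j) = skew_part (vpart X) $ i $ j"
proof -
  have anti: "cE (jmat X $ i $ j) = - cE (jmat X $ j $ i)" for i j
    by (subst jmat_adj) (simp add: ccnj_def)
  have "cE (jmat X $ i $ i) = 0" for i
    using anti[of i i] by (simp add: eq_neg_iff_add_eq_0 flip: scaleR_2)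
  with anti[of 2 1] anti[of 3 2] anti[of 1 3] show ?thesis
    using exhaust_3[of i] exhaust_3[of j] by (auto simp: skew_part_def vpart_def)
qed

lemma cH_jmat: "cH (jmat X $ i $ j) = mpart X $ i $ j"
  by (simp add: mpart_def)

lemma jmat_eq: "jmat X $ i $ j = Cayley (mpart X $ i $ j) (skew_part (vpart X) $ i $ j)"
  by (simp add: cayley_eq_iff cE_jmat cH_jmat)

lemma jordan_eq_iff: "X = Y \<longleftrightarrow> mpart X = mpart Y \<and> vpart X = vpart Y"
proof
  assume "mpart X = mpart Y \<and> vpart X = vpart Y"
  then have "jmat X = jmat Y"
    by (subst vec_eq_iff, subst vec_eq_iff) (simp add: jmat_eq)
  then show "X = Y"
    by (simp add: jmat_inject)
qed simp

lemma mpart_adj: "qmat_adj (mpart X) = mpart X"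
proof -
  have "qcnj (cH (jmat X $ j $ i)) = cH (jmat X $ i $ j)" for i j
    by (subst (2) jmat_adj) (simp add: ccnj_def)
  then show ?thesis
    by (simp add: qmat_adj_def mpart_def vec_eq_iff)
qed

lemma jmat_jordan_of:
  assumes "qmat_adj M = M"
  shows "jmat (jordan_of M a) = (\<chi> i j. Cayley (M $ i $ j) (skew_part a $ i $ j))"
  unfolding jordan_of_def
proof (rule Jordan_inverse)
  have "qcnj (M $ j $ i) = M $ i $ j" for i j
    using assms by (simp add: qmat_adj_def vec_eq_iff)
  then show "(\<chi> i j. Cayley (M $ i $ j) (skew_part a $ i $ j)) \<in> {X. cmat_adj X = X}"
    by (simp add: cmat_adj_def vec_eq_iff cayley_ops skew_part_def forall_3)
qed

lemma mpart_jordan_of: "qmat_adj M = M \<Longrightarrow> mpart (jordan_of M a) = M"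
  by (simp add: mpart_def jmat_jordan_of vec_eq_iff)

lemma vpart_jordan_of: "qmat_adj M = M \<Longrightarrow> vpart (jordan_of M a) = a"
  by (simp add: vpart_def jmat_jordan_of vec_eq_iff skew_part_def forall_3)

lemma linear_mpart: "linear mpart"
  by (rule linearI)
    (simp_all add: mpart_def vec_eq_iff plus_jordan.rep_eq scaleR_jordan.rep_eq cayley_ops)

lemma linear_vpart: "linear vpart"
  by (rule linearI)
    (simp_all add: vpart_def vec_eq_iff plus_jordan.rep_eq scaleR_jordan.rep_eq cayley_ops)

section \<open>Block diagonal matrices and the two involutions\<close>

definition block :: "quat^1^1 \<Rightarrow> quat^2^2 \<Rightarrow> quat^3^3" where
  "block Q B = (\<chi> i j. if i = 1 then if j = 1 then Q $ 1 $ 1 else 0 else if j = 1 then 0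
    else B $ (if i = 2 then 1 else 2) $ (if j = 2 then 1 else 2))"

lemma block_mult: "block Q B ** block Q' B' = block (Q ** Q') (B ** B')"
  by (simp add: block_def matrix_entry sum_3 sum_2 forall_3)

lemma block_adj: "qmat_adj (block Q B) = block (qmat_adj Q) (qmat_adj B)"
  by (simp add: block_def qmat_adj_def vec_eq_iff forall_3 qcnj_zero)

lemma block_one: "block (mat 1) (mat 1) = mat 1"
  by (simp add: block_def mat_def vec_eq_iff forall_3)

lemma block_eq_iff: "block Q B = block Q' B' \<longleftrightarrow> Q = Q' \<and> B = B'"
  by (auto simp add: block_def vec_eq_iff forall_3 forall_2)

lemma block_minus: "block (- Q) (- B) = - block Q B"
  by (simp add: block_def vec_eq_iff forall_3)

definition reflection :: "quat^3^3" where
  "reflection = block (- mat 1) (mat 1)"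

text \<open>Conjugation by \<open>reflection\<close> negates exactly the entries with one index
  equal to 1, so these entries equal their own negatives.\<close>

lemma commutes_reflection_imp_block:
  assumes "A ** reflection = reflection ** A"
  obtains Q B where "A = block Q B"
proof
  have "x = - x \<Longrightarrow> x = 0" "- x = x \<Longrightarrow> x = 0" for x :: quat
    by (simp_all add: quat_ops)
  then show "A = block (\<chi> i j. A $ 1 $ 1) (\<chi> i j. A $ (if i = 1 then 2 else 3) $ (if j = 1 then 2 else 3))"
    using assms by (simp add: reflection_def block_def matrix_entry sum_3 mat_def forall_3)
qed

lemma reflection_Sp: "reflection \<in> Sp"
  by (simp add: reflection_def Sp_def block_adj block_mult block_one qmat_adj_linear matrix_linear)

lemma mpart_gamma: "mpart (gamma X) = mpart X"
  by (simp add: mpart_def gamma.rep_eq vec_eq_iff cgamma_def)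

lemma vpart_gamma: "vpart (gamma X) = - vpart X"
  by (simp add: vpart_def gamma.rep_eq vec_eq_iff cgamma_def)

lemma mpart_sigma: "mpart (sigma X) = reflection ** mpart X ** qmat_adj reflection"
  by (simp add: mpart_def sigma.rep_eq reflection_def block_def qmat_adj_def matrix_entry sum_3
      mat_def forall_3 cayley_ops qcnj_zero qcnj_one qcnj_minus)

text \<open>\<open>sigma\<close> fixes the first entry of the row and negates the other two, the
  opposite of what \<open>reflection\<close> does; hence the sign.\<close>

lemma vpart_sigma: "vpart (sigma X) = - (vpart X ** qmat_adj reflection)"
  by (simp add: vpart_def sigma.rep_eq reflection_def block_def qmat_adj_def matrix_entry sum_3
      mat_def forall_3 cayley_ops qcnj_zero qcnj_one qcnj_minus)

section \<open>The Jordan product in terms of matrices and rows\<close>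

text \<open>The \<open>e_4\<close> coefficients enter through a quaternionic form of [a][b] = b a^T
  - (a . b) 1 for cross product matrices. Symmetrizing makes the scalar term real.\<close>

lemma mpart_half_mult:
  "(\<chi> i j. cH (cmat_mult (jmat X) (jmat Y) $ i $ j)) + (\<chi> i j. cH (cmat_mult (jmat Y) (jmat X) $ i $ j))
   = mpart X ** mpart Y + mpart Y ** mpart X
     - (qmat_adj (vpart X) ** vpart Y + qmat_adj (vpart Y) ** vpart X)
     + (2 * inner (vpart X) (vpart Y)) *\<^sub>R mat 1"
proof -
  have tr: "qcnj a * b + qcnj b * a = (2 * inner a b) *\<^sub>R 1" for a b
    by (simp add: inner_quat_def quat_ops)
  have inner: "2 * inner (vpart X) (vpart Y) = 2 * inner (vpart X $ 1 $ 1) (vpart Y $ 1 $ 1)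
    + 2 * inner (vpart X $ 1 $ 2) (vpart Y $ 1 $ 2) + 2 * inner (vpart X $ 1 $ 3) (vpart Y $ 1 $ 3)"
    by (simp add: inner_vec_def sum_3)
  show ?thesis
    unfolding inner scaleR_add_left
    by (simp add: vec_eq_iff forall_3 cmat_mult_def jmat_eq times_cayley_def
        matrix_matrix_mult_def sum_3 mat_def skew_part_def qmat_adj_def qcnj_minus
        qcnj_zero plus_cayley_def algebra_simps flip: tr)
qed

lemma mpart_mult:
  "mpart (jordan_mult X Y) = (1/2) *\<^sub>R (mpart X ** mpart Y + mpart Y ** mpart X)
     - (1/2) *\<^sub>R (qmat_adj (vpart X) ** vpart Y + qmat_adj (vpart Y) ** vpart X)
     + inner (vpart X) (vpart Y) *\<^sub>R mat 1"
proof -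
  have "mpart (jordan_mult X Y) = (1/2) *\<^sub>R ((\<chi> i j. cH (cmat_mult (jmat X) (jmat Y) $ i $ j))
      + (\<chi> i j. cH (cmat_mult (jmat Y) (jmat X) $ i $ j)))"
    by (simp add: mpart_def jordan_mult.rep_eq vec_eq_iff scaleR_cayley_def plus_cayley_def)
  then show ?thesis
    unfolding mpart_half_mult by (simp add: scaleR_diff_right scaleR_add_right)
qed

lemma vpart_mult:
  "vpart (jordan_mult X Y) = (1/2) *\<^sub>R
     (rtr (mpart X) *\<^sub>R vpart Y + rtr (mpart Y) *\<^sub>R vpart X - vpart X ** mpart Y - vpart Y ** mpart X)"
proof -
  have adj: "qcnj (mpart Z $ i $ j) = mpart Z $ j $ i" for Z i j
    using mpart_adj[of Z] by (simp add: qmat_adj_def vec_eq_iff)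
  have diag: "mpart Z $ i $ i = qre (mpart Z $ i $ i) *\<^sub>R 1" for Z i
    using adj[of Z i i] by (simp add: quat_ops)
  \<comment> \<open>Diagonal entries of a Hermitian matrix are real, so the scalar trace can be
    spread into right multiplications, the shape of the entrywise products.\<close>
  have trace: "rtr (mpart Z) *\<^sub>R q = q * mpart Z $ 1 $ 1 + q * mpart Z $ 2 $ 2 + q * mpart Z $ 3 $ 3" for Z q
    by (subst (1 2 3) diag) (simp add: rtr_def sum_3 scaleR_add_left)
  have "vpart (jordan_mult X Y) = (1/2) *\<^sub>R (\<chi> _ k.
     if k = 1 then cE (cmat_mult (jmat X) (jmat Y) $ 2 $ 3) + cE (cmat_mult (jmat Y) (jmat X) $ 2 $ 3)
     else if k = 2 then cE (cmat_mult (jmat X) (jmat Y) $ 3 $ 1) + cE (cmat_mult (jmat Y) (jmat X) $ 3 $ 1)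
     else cE (cmat_mult (jmat X) (jmat Y) $ 1 $ 2) + cE (cmat_mult (jmat Y) (jmat X) $ 1 $ 2))"
    by (simp add: vpart_def jordan_mult.rep_eq vec_eq_iff scaleR_cayley_def plus_cayley_def)
  also have "\<dots> = (1/2) *\<^sub>R
     (rtr (mpart X) *\<^sub>R vpart Y + rtr (mpart Y) *\<^sub>R vpart X - vpart X ** mpart Y - vpart Y ** mpart X)"
    by (rule arg_cong[where f = "(*\<^sub>R) (1/2)"])
      (simp add: vec_eq_iff forall_3 cmat_mult_def jmat_eq times_cayley_def
        matrix_matrix_mult_def sum_3 skew_part_def adj trace plus_cayley_def algebra_simps)
  finally show ?thesis .
qed

section \<open>The action of symplectic groups\<close>

definition act :: "quat^1^1 \<Rightarrow> quat^3^3 \<Rightarrow> jordan \<Rightarrow> jordan" where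
  "act P A X = jordan_of (A ** mpart X ** qmat_adj A) (P ** vpart X ** qmat_adj A)"

lemma qmat_adj_conj: "qmat_adj M = M \<Longrightarrow> qmat_adj (A ** M ** qmat_adj A) = A ** M ** qmat_adj A"
  by (simp add: qmat_adj_mult qmat_adj_adj matrix_mul_assoc)

lemma mpart_act: "mpart (act P A X) = A ** mpart X ** qmat_adj A"
  by (simp add: act_def mpart_jordan_of qmat_adj_conj mpart_adj)

lemma vpart_act: "vpart (act P A X) = P ** vpart X ** qmat_adj A"
  by (simp add: act_def vpart_jordan_of qmat_adj_conj mpart_adj)

lemma act_comp: "act P A \<circ> act P' A' = act (P ** P') (A ** A')"
  by (simp add: fun_eq_iff jordan_eq_iff mpart_act vpart_act qmat_adj_mult matrix_mul_assoc)

lemma act_one: "act (mat 1) (mat 1) = id"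
  by (simp add: fun_eq_iff jordan_eq_iff mpart_act vpart_act qmat_adj_one)

lemma act_minus: "act (- P) (- A) = act P A"
  by (simp add: fun_eq_iff jordan_eq_iff mpart_act vpart_act qmat_adj_linear matrix_linear)

lemma Sp_cancel:
  assumes "A \<in> Sp"
  shows "X ** A ** qmat_adj A = X" "X ** qmat_adj A ** A = X" "qmat_adj A ** A = mat 1" "A ** qmat_adj A = mat 1"
  using assms by (simp_all add: Sp_adj_left flip: matrix_mul_assoc) (simp_all add: Sp_def)

lemma rtr_conj: "A \<in> Sp \<Longrightarrow> rtr (A ** M ** qmat_adj A) = rtr M"
  by (subst rtr_commute) (simp add: matrix_mul_assoc Sp_cancel)

lemma inner_Sp:
  assumes "P \<in> Sp" "A \<in> Sp"
  shows "inner (P ** a ** qmat_adj A) (P ** b ** qmat_adj A) = inner a b"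
proof -
  have "inner (P ** a ** qmat_adj A) (P ** b ** qmat_adj A) = rtr (P ** (a ** qmat_adj b) ** qmat_adj P)"
    by (simp add: inner_eq_rtr qmat_adj_mult qmat_adj_adj matrix_mul_assoc Sp_cancel assms)
  then show ?thesis
    by (simp only: rtr_conj assms inner_eq_rtr)
qed

lemma linear_act: "linear (act P A)"
  by (rule linearI)
    (simp_all add: jordan_eq_iff mpart_act vpart_act linear_add[OF linear_mpart]
      linear_add[OF linear_vpart] linear_scale[OF linear_mpart] linear_scale[OF linear_vpart]
      matrix_linear)

lemma act_F4:
  assumes P: "P \<in> Sp" and A: "A \<in> Sp"
  shows "act P A \<in> F4"
proof -
  have "bij (act P A)"
    by (rule o_bij[of "act (qmat_adj P) (qmat_adj A)"])
      (simp_all add: act_comp Sp_cancel P A act_one)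
  moreover have "act P A (jordan_mult X Y) = jordan_mult (act P A X) (act P A Y)" for X Y
    by (simp add: jordan_eq_iff mpart_act vpart_act mpart_mult vpart_mult matrix_linear
        qmat_adj_mult qmat_adj_adj matrix_mul_assoc Sp_cancel P A rtr_conj inner_Sp
        scaleR_add_right scaleR_diff_right)
  ultimately show ?thesis
    by (simp add: F4_def linear_act)
qed

lemma gamma_eq_act: "gamma = act (- mat 1) (mat 1)"
  by (simp add: fun_eq_iff jordan_eq_iff mpart_act vpart_act mpart_gamma vpart_gamma qmat_adj_one
      matrix_linear)

lemma sigma_eq_act: "sigma = act (- mat 1) reflection"
  by (simp add: fun_eq_iff jordan_eq_iff mpart_act vpart_act mpart_sigma vpart_sigma matrix_linear)

section \<open>Matrix units and commutants of the Hermitian matrices\<close>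

definition munit :: "'m \<Rightarrow> 'n \<Rightarrow> quat \<Rightarrow> quat^'n^'m" where
  "munit i j q = (\<chi> k l. if k = i \<and> l = j then q else 0)"

lemma munit_mult: "munit i j q ** munit k l r = (if j = k then munit i l (q * r) else 0)"
  by (auto simp: munit_def matrix_entry if_distrib[of "\<lambda>x. x * _"] if_distrib[of "\<lambda>x. _ * x"]
      if_distribR sum.delta cong: if_cong intro!: sum.neutral)

lemma munit_adj: "qmat_adj (munit i j q) = munit j i (qcnj q)"
  by (auto simp: munit_def qmat_adj_def vec_eq_iff qcnj_zero)

lemma munit_sum: "A = (\<Sum>i\<in>UNIV. \<Sum>j\<in>UNIV. munit i j (A $ i $ j))"
proof -
  have "(\<Sum>i\<in>UNIV. \<Sum>j\<in>UNIV. if k = i \<and> l = j then A $ i $ j else 0) = A $ k $ l" for k l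
  proof -
    have "(\<Sum>i\<in>UNIV. \<Sum>j\<in>UNIV. if k = i \<and> l = j then A $ i $ j else 0)
      = (\<Sum>i\<in>UNIV. if k = i then \<Sum>j\<in>UNIV. if l = j then A $ i $ j else 0 else 0)"
      by (intro sum.cong) auto
    then show ?thesis by simp
  qed
  then show ?thesis
    by (simp add: vec_eq_iff munit_def)
qed

text \<open>The Hermitian matrices generate the full matrix ring: with matrix units \<open>e\<^sub>i\<^sub>j\<close>,
  \<open>e\<^sub>i\<^sub>i (q e\<^sub>i\<^sub>j + q\<^sup>* e\<^sub>j\<^sub>i) = q e\<^sub>i\<^sub>j\<close> for distinct \<open>i\<close> and \<open>j\<close>.\<close>
lemma hermitian_commutant:
  fixes T :: "quat^3^1 \<Rightarrow> quat^3^1"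
  assumes lin: "linear T" and herm: "\<And>a N. qmat_adj N = N \<Longrightarrow> T (a ** N) = T a ** N"
  shows "\<exists>h. \<forall>a. T a = h ** a"
proof -
  define S where "S = {N. \<forall>a. T (a ** N) = T a ** N}"
  have S_add: "M + N \<in> S" if "M \<in> S" "N \<in> S" for M N
    using that by (simp add: S_def matrix_linear linear_add[OF lin])
  have S_zero: "0 \<in> S"
    by (simp add: S_def matrix_linear linear_0[OF lin])
  have S_mult: "M ** N \<in> S" if "M \<in> S" "N \<in> S" for M N
    using that by (simp add: S_def matrix_mul_assoc)
  have S_herm: "N \<in> S" if "qmat_adj N = N" for N
    using herm that by (simp add: S_def)
  have off: "munit i j q \<in> S" if "i \<noteq> j" for i j q
  proof -
    have "munit i i 1 \<in> S" "munit i j q + munit j i (qcnj q) \<in> S"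
      by (simp_all add: S_herm munit_adj qmat_adj_add qcnj_qcnj qcnj_one add.commute)
    then have "munit i i 1 ** (munit i j q + munit j i (qcnj q)) \<in> S"
      by (rule S_mult)
    then show ?thesis
      using that by (simp add: matrix_linear munit_mult)
  qed
  have unit: "munit i j q \<in> S" for i j q
  proof (cases "i = j")
    case True
    obtain k :: 3 where "k \<noteq> i"
      using exhaust_3[of i] three_cases by metis
    then have "munit i k q ** munit k i 1 \<in> S"
      by (intro S_mult off) auto
    with True show ?thesis
      by (simp add: munit_mult)
  qed (rule off)
  have sum: "sum f I \<in> S" if "\<And>i. f i \<in> S" for f :: "3 \<Rightarrow> _" and I
    by (induction I rule: infinite_finite_induct) (simp_all add: that S_add S_zero)
  have S: "N \<in> S" for N
    by (subst munit_sum) (intro sum unit)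
  \<comment> \<open>With \<open>a = e ** R a\<close>, the map \<open>T\<close> is determined by
    \<open>T e\<close>. Only the first row of \<open>R a\<close> is nonzero, so only the first entry
    of \<open>T e\<close> matters.\<close>
  define R :: "quat^3^1 \<Rightarrow> quat^3^3" where "R a = (\<chi> i j. if i = 1 then a $ 1 $ j else 0)" for a
  define e :: "quat^3^1" where "e = munit 1 1 1"
  define h :: "quat^1^1" where "h = (\<chi> i j. T e $ 1 $ 1)"
  have "T a = h ** a" for a
  proof -
    have "e ** R a = a"
      by (simp add: e_def R_def munit_def matrix_entry sum_3)
    then have "T a = T e ** R a"
      using S[of "R a"] by (simp add: S_def) metis
    also have "\<dots> = h ** a"
      by (simp add: h_def R_def matrix_entry sum_3 sum_1)
    finally show ?thesis .
  qed
  then show ?thesis by blast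
qed

text \<open>Right multiplication by \<open>A\<close> commutes with all Hermitian matrices, so
  \<open>hermitian_commutant\<close> makes it left multiplication by some \<open>h\<close>. Testing
  on unit rows gives \<open>A\<close> as \<open>h\<close> times the identity; testing on their
  quaternion multiples makes \<open>h\<close> central, hence real.\<close>

lemma commutes_hermitian_imp_scalar:
  fixes A :: "quat^3^3"
  assumes "\<And>N. qmat_adj N = N \<Longrightarrow> A ** N = N ** A"
  obtains c where "A = c *\<^sub>R mat 1"
proof -
  have "linear (\<lambda>a :: quat^3^1. a ** A)"
    by (rule linearI) (simp_all add: matrix_linear)
  moreover have "a ** N ** A = a ** A ** N" if "qmat_adj N = N" for N and a :: "quat^3^1"
    using assms[OF that] by (metis matrix_mul_assoc)
  ultimately obtain h where h: "\<And>a :: quat^3^1. a ** A = h ** a"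
    using hermitian_commutant[of "\<lambda>a. a ** A"] by blast
  have eq: "q * A $ i $ j = (if i = j then h $ 1 $ 1 * q else 0)" for q i j
  proof -
    have "(munit 1 i q ** A) $ 1 $ j = q * A $ i $ j"
      by (simp add: munit_def matrix_matrix_mult_def if_distrib[of "\<lambda>x. x * _"] cong: if_cong)
    moreover have "(h ** munit 1 i q) $ 1 $ j = (if i = j then h $ 1 $ 1 * q else 0)"
      by (auto simp: munit_def matrix_matrix_mult_def sum_1)
    ultimately show ?thesis
      using h[of "munit 1 i q"] by metis
  qed
  from eq[of 1] have A: "A $ i $ j = (if i = j then h $ 1 $ 1 else 0)" for i j
    by simp
  with eq[of _ 1 1] have "\<forall>q. h $ 1 $ 1 * q = q * h $ 1 $ 1"
    by simp
  then have "h $ 1 $ 1 = of_real (qre (h $ 1 $ 1))"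
    by (simp only: quat_central_iff)
  with A have "A = qre (h $ 1 $ 1) *\<^sub>R mat 1"
    by (simp add: vec_eq_iff mat_def of_real_def)
  then show ?thesis by (rule that)
qed

text \<open>Testing on Hermitian matrices makes \<open>A\<close> a real scalar \<open>c\<close> with
  \<open>c * c = 1\<close>; testing on one unit row then gives \<open>P\<close> the same
  sign.\<close>

lemma act_eq_id_iff:
  assumes A: "A \<in> Sp"
  shows "act P A = id \<longleftrightarrow> (P, A) = (mat 1, mat 1) \<or> (P, A) = (- mat 1, - mat 1)"
proof
  assume id: "act P A = id"
  have "A ** N = N ** A" if "qmat_adj N = N" for N
  proof -
    have "mpart (act P A (jordan_of N 0)) = N"
      using that by (simp add: id mpart_jordan_of)
    then have "A ** N ** qmat_adj A = N"
      using that by (simp add: mpart_act mpart_jordan_of)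
    then show ?thesis
      using Sp_cancel(2)[OF A] by metis
  qed
  then obtain c where c: "A = c *\<^sub>R mat 1"
    using commutes_hermitian_imp_scalar by blast
  have "(c * c) *\<^sub>R mat 1 = (mat 1 :: quat^3^3)"
    using A by (simp add: c Sp_def qmat_adj_linear matrix_linear)
  then have "((c * c) *\<^sub>R (mat 1 :: quat^3^3)) $ 1 $ 1 = (mat 1 :: quat^3^3) $ 1 $ 1"
    by (rule arg_cong)
  then have cc: "c * c = 1"
    by (simp add: mat_def quat_ops)
  have "vpart (act P A (jordan_of 0 (munit 1 1 1))) = munit 1 1 1"
    by (simp add: id vpart_jordan_of qmat_adj_zero)
  then have "(c *\<^sub>R P ** munit 1 1 1) $ 1 $ (1::3) = (munit 1 1 1 :: quat^3^1) $ 1 $ 1"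
    by (simp add: vpart_act vpart_jordan_of qmat_adj_linear c matrix_linear)
  then have "c *\<^sub>R P $ 1 $ 1 = 1"
    by (simp add: munit_def matrix_matrix_mult_def sum_1)
  then have "P = c *\<^sub>R mat 1"
    using cc by (simp add: vec_eq_iff mat_def) (metis scaleR_one scaleR_scaleR)
  moreover have "c = 1 \<or> c = -1"
    using cc by (metis square_eq_1_iff)
  ultimately show "(P, A) = (mat 1, mat 1) \<or> (P, A) = (- mat 1, - mat 1)"
    using c by auto
qed (auto simp: act_one act_minus)

section \<open>Automorphisms commuting with gamma\<close>

definition scal :: "quat \<Rightarrow> quat^1^1" where
  "scal q = (\<chi> i j. q)"

lemma scal_mult: "scal (p * q) = scal p ** scal q"
  by (simp add: scal_def matrix_entry sum_1)

lemma scal_add: "scal (p + q) = scal p + scal q"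
  and scal_scaleR: "scal (r *\<^sub>R p) = r *\<^sub>R scal p"
  and scal_adj: "qmat_adj (scal p) = scal (qcnj p)"
  by (simp_all add: scal_def vec_eq_iff qmat_adj_def)

lemma scal_one: "scal 1 = mat 1"
  by (simp add: scal_def vec_eq_iff mat_def)

lemma scal_entry: "scal (h $ 1 $ 1) = h"
  by (simp add: scal_def vec_eq_iff)

lemma scal_Sp: "norm p = 1 \<Longrightarrow> scal p \<in> Sp"
  by (simp add: Sp_def scal_adj scal_one mult_qcnj norm_eq_1 flip: scal_mult)

lemma scal_cancel: "(\<forall>a :: quat^3^1. scal p ** a = scal q ** a) \<longleftrightarrow> p = q"
proof
  assume "\<forall>a :: quat^3^1. scal p ** a = scal q ** a"
  then have "(scal p ** munit 1 1 1) $ 1 $ (1::3) = (scal q ** munit 1 1 1) $ 1 $ (1::3)"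
    by metis
  then show "p = q"
    by (simp add: scal_def munit_def matrix_matrix_mult_def sum_1)
qed simp

lemma row_cancel:
  fixes M N :: "quat^3^3"
  assumes "\<And>a :: quat^3^1. a ** M = a ** N"
  shows "M = N"
proof -
  have "((munit 1 i 1 :: quat^3^1) ** M) $ 1 $ j = ((munit 1 i 1 :: quat^3^1) ** N) $ 1 $ j" for i j
    by (simp add: assms)
  then show ?thesis
    by (simp add: munit_def matrix_matrix_mult_def vec_eq_iff if_distrib[of "\<lambda>x. x * _"] cong: if_cong)
qed

text \<open>Conjugation by \<open>g\<close> sends left multiplications to maps commuting with
  Hermitian matrices, again left multiplications. This is an endomorphism \<open>\<theta>\<close> of
  the quaternions, which is conjugation by a unit \<open>p\<close>. Removing \<open>p\<close> from
  \<open>g\<close> leaves a map linear over left quaternion scalars, hence right multiplication by a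
  matrix.\<close>

lemma normalizes_hermitian_imp_matrix:
  fixes g :: "quat^3^1 \<Rightarrow> quat^3^1"
  assumes lin: "linear g" and bij: "bij g"
    and herm: "\<And>N'. qmat_adj N' = N' \<Longrightarrow> \<exists>N. qmat_adj N = N \<and> (\<forall>a. g (a ** N) = g a ** N')"
  obtains P C where "P \<in> Sp" "\<And>a. g a = P ** a ** C"
proof -
  define g' where "g' = inv_into UNIV g"
  have g_g': "g (g' b) = b" and g'_g: "g' (g a) = a" for a b
    using bij by (simp_all add: g'_def bij_is_surj surj_f_inv_f bij_is_inj)
  have lin': "linear g'"
    unfolding g'_def using lin bij_is_inj[OF bij] by (rule inj_linear_imp_inv_linear)
  have "\<exists>q. \<forall>a. g (scal h ** a) = scal q ** g a" for h
  proof -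
    have "linear (\<lambda>b. g (scal h ** g' b))"
      by (rule linearI)
        (simp_all add: linear_add[OF lin] linear_add[OF lin'] linear_scale[OF lin]
          linear_scale[OF lin'] matrix_linear)
    moreover have "g (scal h ** g' (b ** N')) = g (scal h ** g' b) ** N'"
      if N': "qmat_adj N' = N'" for b N'
    proof -
      obtain N where N: "\<And>a. g (a ** N) = g a ** N'"
        using herm[OF N'] by blast
      have "g' (b ** N') = g' b ** N"
        by (metis N g_g' g'_g)
      then show ?thesis
        by (simp add: N matrix_mul_assoc)
    qed
    ultimately obtain H where "\<And>b. g (scal h ** g' b) = H ** b"
      using hermitian_commutant[of "\<lambda>b. g (scal h ** g' b)"] by blast
    then have "g (scal h ** a) = scal (H $ 1 $ 1) ** g a" for a
      by (metis g'_g scal_entry)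
    then show ?thesis by blast
  qed
  then obtain \<theta> where \<theta>: "\<And>h a. g (scal h ** a) = scal (\<theta> h) ** g a"
    by metis
  \<comment> \<open>Since \<open>g\<close> is onto, \<open>\<theta> h\<close> is the only scalar
    that can occur; linearity and multiplicativity of \<open>\<theta>\<close> follow from this
    uniqueness.\<close>
  have \<theta>_eqI: "\<theta> h = q" if "\<And>a. g (scal h ** a) = scal q ** g a" for h q
    using that by (metis \<theta> g_g' scal_cancel)
  have "linear \<theta>"
    by (rule linearI; rule \<theta>_eqI)
      (simp_all add: scal_add scal_scaleR matrix_linear linear_add[OF lin] linear_scale[OF lin] \<theta>)
  moreover have "\<theta> 1 = 1"
    by (rule \<theta>_eqI) (simp add: scal_one)
  moreover have "\<theta> (x * y) = \<theta> x * \<theta> y" for x y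
    by (rule \<theta>_eqI) (simp add: scal_mult \<theta> flip: matrix_mul_assoc)
  ultimately obtain p where p: "norm p = 1" and \<theta>_p: "\<And>h. \<theta> h = p * h * qcnj p"
    by (rule skolem_noether_quat) blast
  have pp: "qcnj p * p = 1" "p * qcnj p = 1"
    using p by (simp_all add: mult_qcnj qcnj_mult_self norm_eq_1)
  define k where "k a = scal (qcnj p) ** g a" for a
  have k_scal: "k (scal h ** a) = scal h ** k a" for h a
    by (simp add: k_def \<theta> \<theta>_p flip: scal_mult mult.assoc)
      (simp add: pp matrix_mul_assoc flip: scal_mult mult.assoc)
  have lin_k: "linear k"
    by (rule linearI) (simp_all add: k_def linear_add[OF lin] linear_scale[OF lin] matrix_linear)
  define C :: "quat^3^3" where "C = (\<chi> i j. k (munit 1 i 1) $ 1 $ j)"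
  have k_C: "k a = a ** C" for a
  proof -
    have "a = (\<Sum>i\<in>UNIV. scal (a $ 1 $ i) ** munit 1 i 1)"
      by (simp add: vec_eq_iff scal_def matrix_matrix_mult_def munit_def sum_1 sum_3 forall_3)
    then have "k a = k (\<Sum>i\<in>UNIV. scal (a $ 1 $ i) ** munit 1 i 1)"
      by simp
    also have "\<dots> = (\<Sum>i\<in>UNIV. scal (a $ 1 $ i) ** k (munit 1 i 1))"
      by (simp add: linear_sum[OF lin_k] k_scal)
    also have "\<dots> = a ** C"
      by (simp add: vec_eq_iff matrix_matrix_mult_def C_def scal_def sum_1)
    finally show ?thesis .
  qed
  have "g a = scal p ** a ** C" for a
  proof -
    have "scal p ** k a = g a"
      by (simp add: k_def matrix_mul_assoc pp scal_one flip: scal_mult)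
    then show ?thesis
      by (simp add: k_C matrix_mul_assoc)
  qed
  with scal_Sp[OF p] that show ?thesis by blast
qed

lemma neg_eq_self_iff: "- v = v \<longleftrightarrow> v = 0" "v = - v \<longleftrightarrow> v = 0" for v :: "'a::real_vector"
  by (metis add.right_inverse minus_zero scaleR_2 scaleR_eq_0_iff zero_neq_numeral)+

lemma F4_gamma_imp_act:
  assumes \<alpha>: "\<alpha> \<in> F4" and comm: "\<And>X. \<alpha> (gamma X) = gamma (\<alpha> X)"
  obtains P A where "P \<in> Sp" "A \<in> Sp" "\<alpha> = act P A"
proof -
  have lin: "linear \<alpha>" and bij: "bij \<alpha>"
    and mult: "\<And>X Y. \<alpha> (jordan_mult X Y) = jordan_mult (\<alpha> X) (\<alpha> Y)"
    using \<alpha> by (auto simp: F4_def)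
  \<comment> \<open>The summands \<open>vpart X = 0\<close> and \<open>mpart X = 0\<close> are the
    eigenspaces of \<open>gamma\<close> for 1 and -1, so \<open>\<alpha>\<close> preserves
    both.\<close>
  have even: "vpart (\<alpha> X) = 0 \<longleftrightarrow> vpart X = 0" for X
  proof -
    have "vpart X = 0 \<longleftrightarrow> gamma X = X" for X
      by (simp add: jordan_eq_iff mpart_gamma vpart_gamma neg_eq_self_iff)
    moreover have "gamma X = X \<longleftrightarrow> gamma (\<alpha> X) = \<alpha> X"
      using bij comm by (metis bij_is_inj injD)
    ultimately show ?thesis by simp
  qed
  have odd: "mpart (\<alpha> X) = 0 \<longleftrightarrow> mpart X = 0" for X
  proof -
    have "mpart X = 0 \<longleftrightarrow> gamma X = - X" for X
      by (simp add: jordan_eq_iff mpart_gamma vpart_gamma linear_neg[OF linear_mpart]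
          linear_neg[OF linear_vpart] neg_eq_self_iff)
    moreover have "gamma X = - X \<longleftrightarrow> gamma (\<alpha> X) = - \<alpha> X"
      using bij comm linear_neg[OF lin] by (metis bij_is_inj injD)
    ultimately show ?thesis by simp
  qed
  define J where "J M = jordan_of M 0" for M
  define V where "V a = jordan_of 0 a" for a
  have J: "mpart (J M) = M" "vpart (J M) = 0" if "qmat_adj M = M" for M
    using that by (simp_all add: J_def mpart_jordan_of vpart_jordan_of)
  have V: "mpart (V a) = 0" "vpart (V a) = a" for a
    by (simp_all add: V_def mpart_jordan_of vpart_jordan_of qmat_adj_zero)
  define f where "f M = mpart (\<alpha> (J M))" for M
  define g where "g a = vpart (\<alpha> (V a))" for a
  have \<alpha>_J: "\<alpha> (J M) = J (f M)" if "qmat_adj M = M" for M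
    using that by (simp add: jordan_eq_iff f_def J mpart_adj even)
  have \<alpha>_V: "\<alpha> (V a) = V (g a)" for a
    by (simp add: jordan_eq_iff g_def V odd)
  have f_adj: "qmat_adj (f M) = f M" for M
    by (simp add: f_def mpart_adj)
  have "V (a + b) = V a + V b" "V (r *\<^sub>R a) = r *\<^sub>R V a" for a b r
    by (simp_all add: jordan_eq_iff V linear_add[OF linear_mpart] linear_add[OF linear_vpart]
      linear_scale[OF linear_mpart] linear_scale[OF linear_vpart])
  then have lin_g: "linear g"
    by (intro linearI) (simp_all add: g_def linear_add[OF lin] linear_add[OF linear_vpart]
      linear_scale[OF lin] linear_scale[OF linear_vpart])
  have bij_g: "bij g"
  proof (rule bijI)
    show "inj g"
      by (rule injI) (metis \<alpha>_V V(2) bij bij_is_inj injD)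
    show "surj g"
      unfolding surj_def
    proof
      fix b
      obtain X where X: "\<alpha> X = V b"
        using bij by (metis bij_is_surj surjD)
      then have "X = V (vpart X)"
        by (metis V jordan_eq_iff odd)
      with X have "b = g (vpart X)"
        by (metis V(2) g_def)
      then show "\<exists>a. b = g a" by blast
    qed
  qed
  have surj_f: "\<exists>M. qmat_adj M = M \<and> f M = N" if N: "qmat_adj N = N" for N
  proof -
    obtain X where X: "\<alpha> X = J N"
      using bij by (metis bij_is_surj surjD)
    then have "vpart X = 0"
      using even J(2)[OF N] by metis
    then have "X = J (mpart X)"
      by (simp add: jordan_eq_iff J mpart_adj)
    with X show ?thesis
      by (metis J(1) N f_def mpart_adj)
  qed
  \<comment> \<open>By \<open>vpart_mult\<close>, the Jordan product of \<open>J M\<close> and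
    \<open>V a\<close> is half of \<open>V (a ** \<rho> M)\<close>.\<close>
  define \<rho> :: "quat^3^3 \<Rightarrow> quat^3^3" where "\<rho> M = rtr M *\<^sub>R mat 1 - M" for M
  have rtr_one: "rtr (mat 1 :: quat^3^3) = 3"
    by (simp add: rtr_def mat_def sum_3 one_quat_def)
  have rtr_\<rho>: "rtr (\<rho> M) = 2 * rtr M" for M
    by (simp add: \<rho>_def linear_diff[OF linear_rtr] linear_scale[OF linear_rtr] rtr_one)
  have \<rho>_adj: "qmat_adj (\<rho> M) = \<rho> M" if "qmat_adj M = M" for M
    using that by (simp add: \<rho>_def qmat_adj_linear)
  have surj_\<rho>: "\<exists>M. qmat_adj M = M \<and> \<rho> M = N" if N: "qmat_adj N = N" for N
  \<comment> \<open>As \<open>\<rho>\<close> doubles the trace, a preimage of \<open>N\<close> has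
    trace \<open>rtr N / 2\<close>, which determines the witness.\<close>
  proof (intro exI conjI)
    show "qmat_adj ((rtr N / 2) *\<^sub>R mat 1 - N) = (rtr N / 2) *\<^sub>R mat 1 - N"
      by (simp add: qmat_adj_linear N)
    have "rtr ((rtr N / 2) *\<^sub>R mat 1 - N) = rtr N / 2"
      by (simp add: linear_diff[OF linear_rtr] linear_scale[OF linear_rtr] rtr_one)
    then show "\<rho> ((rtr N / 2) *\<^sub>R mat 1 - N) = N"
      by (simp add: \<rho>_def)
  qed
  have intertwine: "g (a ** \<rho> M) = g a ** \<rho> (f M)" if M: "qmat_adj M = M" for a M
  proof -
    have *: "vpart (jordan_mult (J M) (V a)) = (1/2) *\<^sub>R (a ** \<rho> M)" if "qmat_adj M = M" for a M
      using that by (simp add: vpart_mult J V \<rho>_def matrix_linear)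
    have "mpart (jordan_mult (J M) (V a)) = 0"
      by (simp add: mpart_mult J M V matrix_linear qmat_adj_linear)
    then have "jordan_mult (J M) (V a) = V ((1/2) *\<^sub>R (a ** \<rho> M))"
      by (simp add: jordan_eq_iff V * M)
    then have "V (g ((1/2) *\<^sub>R (a ** \<rho> M))) = jordan_mult (J (f M)) (V (g a))"
      by (metis \<alpha>_J[OF M] \<alpha>_V mult)
    then have "g ((1/2) *\<^sub>R (a ** \<rho> M)) = (1/2) *\<^sub>R (g a ** \<rho> (f M))"
      using *[OF f_adj] V(2) by metis
    then show ?thesis
      by (simp add: linear_scale[OF lin_g])
  qed
  have herm: "\<exists>N. qmat_adj N = N \<and> (\<forall>a. g (a ** N) = g a ** N')" if "qmat_adj N' = N'" for N'
    by (metis surj_\<rho>[OF that] surj_f intertwine \<rho>_adj)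
  obtain P C where P: "P \<in> Sp" and g: "\<And>a. g a = P ** a ** C"
    using normalizes_hermitian_imp_matrix[OF lin_g bij_g herm] by blast
  have intertwine_C: "\<rho> M ** C = C ** \<rho> (f M)" if "qmat_adj M = M" for M
  proof (rule row_cancel)
    fix a :: "quat^3^1"
    have "qmat_adj P ** (P ** (a ** \<rho> M) ** C) = qmat_adj P ** (P ** a ** C ** \<rho> (f M))"
      using intertwine[OF that, of a] by (simp add: g)
    then show "a ** (\<rho> M ** C) = a ** (C ** \<rho> (f M))"
      by (simp add: matrix_mul_assoc Sp_cancel P)
  qed
  \<comment> \<open>From N C = C N' and its adjoint C^* N = N' C^*, both sides equal C N'
    C^*.\<close>
  have "(C ** qmat_adj C) ** N = N ** (C ** qmat_adj C)" if N: "qmat_adj N = N" for N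
  proof -
    obtain N' where N': "qmat_adj N' = N'" "N ** C = C ** N'"
      by (metis surj_\<rho>[OF N] intertwine_C f_adj \<rho>_adj)
    then have "qmat_adj C ** N = N' ** qmat_adj C"
      by (metis N qmat_adj_mult)
    with N' show ?thesis
      by (metis matrix_mul_assoc)
  qed
  then obtain c where c: "C ** qmat_adj C = c *\<^sub>R mat 1"
    using commutes_hermitian_imp_scalar by blast
  \<comment> \<open>The factor \<open>c\<close> is how much \<open>g\<close> scales squared lengths;
    injectivity of \<open>g\<close> then makes it positive, so that \<open>C\<close> can be
    normalized.\<close>
  have "inner (P ** a ** C) (P ** a ** C) = c * inner a a" for a
  proof -
    have "inner (P ** a ** C) (P ** a ** C) = rtr (P ** (a ** (C ** qmat_adj C) ** qmat_adj a) ** qmat_adj P)"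
      by (simp add: inner_eq_rtr qmat_adj_mult matrix_mul_assoc)
    also have "\<dots> = c * inner a a"
      by (simp only: rtr_conj[OF P])
        (simp add: c matrix_linear inner_eq_rtr linear_scale[OF linear_rtr])
    finally show ?thesis .
  qed
  then have inner_g: "inner (g a) (g a) = c * inner a a" for a
    by (simp add: g)
  define e :: "quat^3^1" where "e = munit 1 1 1"
  have "e $ 1 $ 1 = 1"
    by (simp add: e_def munit_def)
  then have e: "inner e e > 0"
    by (metis inner_gt_zero_iff zero_index zero_neq_one)
  have "g e \<noteq> 0"
    using bij_g e linear_0[OF lin_g] by (metis bij_is_inj injD inner_zero_left less_irrefl)
  then have c_pos: "c > 0"
    using inner_g[of e] e by (metis inner_gt_zero_iff zero_less_mult_pos2)
  define A where "A = (1 / sqrt c) *\<^sub>R qmat_adj C"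
  have C_A: "C = sqrt c *\<^sub>R qmat_adj A"
    using c_pos by (simp add: A_def qmat_adj_linear qmat_adj_adj)
  have "qmat_adj A \<in> Sp"
    using c_pos by (simp add: Sp_def A_def qmat_adj_linear qmat_adj_adj matrix_linear c)
  then have A: "A \<in> Sp"
    using Sp_adj qmat_adj_adj by metis
  have \<rho>_f: "\<rho> (f M) = A ** \<rho> M ** qmat_adj A" if "qmat_adj M = M" for M
  proof -
    have "\<rho> M ** qmat_adj A = qmat_adj A ** \<rho> (f M)"
      using intertwine_C[OF that] c_pos by (simp add: C_A matrix_linear)
    then have "A ** (\<rho> M ** qmat_adj A) = A ** (qmat_adj A ** \<rho> (f M))"
      by simp
    then show ?thesis
      by (simp add: matrix_mul_assoc Sp_cancel A)
  qed
  \<comment> \<open>Comparing traces in \<open>\<rho>_f\<close> shows that \<open>f\<close>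
    preserves the trace, which allows \<open>\<rho>\<close> to be removed from that
    identity.\<close>
  have rtr_f: "rtr (f M) = rtr M" if "qmat_adj M = M" for M
    using arg_cong[OF \<rho>_f[OF that], of rtr] by (simp add: rtr_conj A rtr_\<rho>)
  have f: "f M = A ** M ** qmat_adj A" if "qmat_adj M = M" for M
    using \<rho>_f[OF that] by (simp add: \<rho>_def rtr_f that matrix_linear Sp_cancel A)
  \<comment> \<open>What remains is the scale \<open>c\<close>. The trace of the Jordan square of a
    row measures its length and is preserved by \<open>\<alpha>\<close>, forcing
    \<open>c = 1\<close>.\<close>
  have square: "rtr (mpart (jordan_mult (V a) (V a))) = 2 * inner a a" for a
    by (simp add: mpart_mult V matrix_linear linear_diff[OF linear_rtr] linear_add[OF linear_rtr]
        linear_scale[OF linear_rtr] rtr_one inner_eq_rtr rtr_commute[of "qmat_adj a"]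
        linear_0[OF linear_rtr])
  have "vpart (jordan_mult (V e) (V e)) = 0"
    by (simp add: vpart_mult V matrix_linear linear_0[OF linear_rtr])
  then have "jordan_mult (V e) (V e) = J (mpart (jordan_mult (V e) (V e)))"
    by (simp add: jordan_eq_iff J mpart_adj)
  then have "mpart (jordan_mult (V (g e)) (V (g e))) = f (mpart (jordan_mult (V e) (V e)))"
    by (metis \<alpha>_V f_def mult)
  then have "inner (g e) (g e) = inner e e"
    using square by (metis mult_cancel_left mpart_adj rtr_f zero_neq_numeral)
  then have "c = 1"
    using inner_g[of e] e by simp
  then have g_A: "g a = P ** a ** qmat_adj A" for a
    by (simp add: g C_A)
  have "\<alpha> = act P A"
  proof
    fix X
    have "X = J (mpart X) + V (vpart X)"
      by (simp add: jordan_eq_iff J V mpart_adj linear_add[OF linear_mpart] linear_add[OF linear_vpart])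
    then have "\<alpha> X = J (f (mpart X)) + V (g (vpart X))"
      by (metis \<alpha>_J \<alpha>_V lin linear_add mpart_adj)
    then show "\<alpha> X = act P A X"
      by (simp add: jordan_eq_iff J V f_adj linear_add[OF linear_mpart] linear_add[OF linear_vpart]
          mpart_act vpart_act f g_A mpart_adj qmat_adj_conj)
  qed
  with P A that show ?thesis by blast
qed

section \<open>The isomorphism\<close>

lemma reflection_mult: "reflection ** reflection = mat 1"
  by (simp add: reflection_def block_mult matrix_linear block_one)

lemma gamma_sigma_eq_act: "gamma \<circ> sigma = act (mat 1) reflection"
  by (simp add: gamma_eq_act sigma_eq_act act_comp matrix_linear)

lemma inv_gamma_sigma: "inv_into UNIV (gamma \<circ> sigma) = gamma \<circ> sigma"
  by (rule inv_unique_comp) (simp_all add: gamma_sigma_eq_act act_comp reflection_mult act_one)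

lemma block_Sp_iff: "block Q B \<in> Sp \<longleftrightarrow> Q \<in> Sp \<and> B \<in> Sp"
  unfolding Sp_def mem_Collect_eq block_adj block_mult
  by (simp add: block_eq_iff flip: block_one)

definition block_act :: "(quat^1^1) \<times> (quat^1^1) \<times> (quat^2^2) \<Rightarrow> jordan \<Rightarrow> jordan" where
  "block_act = (\<lambda>(P, Q, B). act P (block Q B))"

text \<open>An element commuting with \<open>gamma\<close> is some \<open>act P A\<close>; as
  \<open>gamma \<circ> sigma\<close> acts by \<open>reflection\<close> with trivial left factor,
  commuting with it compares \<open>A\<close> with its conjugate by
  \<open>reflection\<close>.\<close>

lemma block_act_image: "block_act ` carrier Sp1_Sp1_Sp2 = F4_gamma \<inter> F4_gamma_sigma"
proof
  show "block_act ` carrier Sp1_Sp1_Sp2 \<subseteq> F4_gamma \<inter> F4_gamma_sigma"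
    by (auto simp: block_act_def Sp_group_def F4_gamma_def F4_gamma_sigma_def inv_gamma_sigma
        act_F4 block_Sp_iff)
      (simp_all add: gamma_eq_act sigma_eq_act act_comp matrix_linear reflection_def block_mult)
next
  show "F4_gamma \<inter> F4_gamma_sigma \<subseteq> block_act ` carrier Sp1_Sp1_Sp2"
  proof
    fix \<alpha> assume "\<alpha> \<in> F4_gamma \<inter> F4_gamma_sigma"
    then have \<alpha>: "\<alpha> \<in> F4" and \<gamma>: "gamma \<circ> \<alpha> \<circ> gamma = \<alpha>"
      and \<gamma>\<sigma>: "(gamma \<circ> sigma) \<circ> \<alpha> \<circ> (gamma \<circ> sigma) = \<alpha>"
      unfolding F4_gamma_def F4_gamma_sigma_def inv_gamma_sigma by auto
    have "\<alpha> (gamma X) = gamma (\<alpha> X)" for X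
      using \<gamma> gamma_gamma by (metis comp_apply id_apply)
    then obtain P A where P: "P \<in> Sp" and A: "A \<in> Sp" and eq: "\<alpha> = act P A"
      using F4_gamma_imp_act[OF \<alpha>] by blast
    have "act P (reflection ** A ** reflection) = act P A"
      using \<gamma>\<sigma> by (simp add: eq gamma_sigma_eq_act act_comp)
    then have "act (qmat_adj P) (qmat_adj A) \<circ> act P (reflection ** A ** reflection)
      = act (qmat_adj P) (qmat_adj A) \<circ> act P A"
      by simp
    then have "act (mat 1) (qmat_adj A ** (reflection ** A ** reflection)) = id"
      by (simp add: act_comp Sp_cancel P A act_one)
    moreover have "qmat_adj A ** (reflection ** A ** reflection) \<in> Sp"
      by (intro Sp_mult Sp_adj A reflection_Sp)
    \<comment> \<open>Rules out the sign ambiguity in \<open>act_eq_id_iff\<close>: the left factor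
      here is \<open>mat 1\<close>, so \<open>A\<close> equals its conjugate exactly and not up to
      sign.\<close>
    moreover have "mat 1 \<noteq> - (mat 1 :: quat^1^1)"
      by (simp add: mat_def vec_eq_iff quat_ops)
    ultimately have "qmat_adj A ** (reflection ** A ** reflection) = mat 1"
      using act_eq_id_iff by blast
    then have "A ** (qmat_adj A ** (reflection ** A ** reflection)) ** reflection = A ** reflection"
      by simp
    then have "A ** reflection = reflection ** A"
      by (simp add: matrix_mul_assoc Sp_cancel A)
        (simp add: reflection_mult flip: matrix_mul_assoc)
    then obtain Q B where "A = block Q B"
      by (rule commutes_reflection_imp_block)
    with A P show "\<alpha> \<in> block_act ` carrier Sp1_Sp1_Sp2"
      by (force simp: block_act_def eq block_Sp_iff Sp_group_def)
  qed
qed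

lemma group_Sp1_Sp1_Sp2: "group Sp1_Sp1_Sp2"
  by (intro DirProd_group group_Sp)

lemma block_act_hom: "block_act \<in> hom Sp1_Sp1_Sp2 F4_group"
  by (rule homI)
    (auto simp: Sp_group_def F4_group_def block_act_def act_F4 block_Sp_iff act_comp block_mult)

text \<open>The intersection gets its group structure as the image of \<open>block_act\<close>. The
  updated unit in the proof is the form in which \<open>group.hom_imp_img_group\<close> describes an
  image.\<close>

lemma block_act_group_hom:
  "group_hom Sp1_Sp1_Sp2 (F4_group\<lparr>carrier := F4_gamma \<inter> F4_gamma_sigma\<rparr>) block_act"
proof -
  have "block_act \<one>\<^bsub>Sp1_Sp1_Sp2\<^esub> = \<one>\<^bsub>F4_group\<^esub>"
    by (simp add: block_act_def Sp_group_def F4_group_def block_one act_one)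
  then have "group (F4_group\<lparr>carrier := F4_gamma \<inter> F4_gamma_sigma, one := \<one>\<^bsub>F4_group\<^esub>\<rparr>)"
    using group.hom_imp_img_group[OF group_Sp1_Sp1_Sp2 block_act_hom]
    by (simp only: block_act_image)
  then have "group (F4_group\<lparr>carrier := F4_gamma \<inter> F4_gamma_sigma\<rparr>)"
    by simp
  moreover have "block_act \<in> hom Sp1_Sp1_Sp2 (F4_group\<lparr>carrier := F4_gamma \<inter> F4_gamma_sigma\<rparr>)"
    using block_act_hom block_act_image by (auto simp: hom_def)
  ultimately show ?thesis
    by (simp add: group_hom_def group_hom_axioms_def group_Sp1_Sp1_Sp2)
qed

lemma block_act_kernel:
  "kernel Sp1_Sp1_Sp2 (F4_group\<lparr>carrier := F4_gamma \<inter> F4_gamma_sigma\<rparr>) block_act = Z2"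
proof -
  have "- mat 1 = block (- mat 1) (- mat 1)"
    by (simp add: block_minus block_one)
  then have "block_act (P, Q, B) = id \<longleftrightarrow> (P, Q, B) \<in> Z2" if "Q \<in> Sp" "B \<in> Sp" for P Q B
    using that act_eq_id_iff[of "block Q B" P] block_eq_iff[of Q B "mat 1" "mat 1"]
      block_eq_iff[of Q B "- mat 1" "- mat 1"]
    by (auto simp: block_act_def Z2_def block_Sp_iff block_one)
  moreover have "Z2 \<subseteq> carrier Sp1_Sp1_Sp2"
    by (auto simp: Z2_def Sp_group_def Sp_one Sp_minus)
  ultimately show ?thesis
    by (auto simp: kernel_def Sp_group_def F4_group_def)
qed

section \<open>Continuity of the action and the quotient homeomorphism\<close>

text \<open>Distances in \<open>jordan\<close> and \<open>cayley\<close> agree with those of the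
  underlying matrices and of pairs of quaternions, so continuity can be tested on
  coefficients.\<close>

lemma continuous_on_jordan:
  assumes "\<And>i j. continuous_on S (\<lambda>x. cH (jmat (f x) $ i $ j))"
    and "\<And>i j. continuous_on S (\<lambda>x. cE (jmat (f x) $ i $ j))"
  shows "continuous_on S f"
proof -
  have norm_cayley: "norm (x :: cayley) = norm (cH x, cE x)" for x
    by (simp add: norm_cayley_def inner_cayley_def norm_prod_def norm_eq_sqrt_inner)
  have dist_cayley: "dist x y = dist (cH x, cE x) (cH y, cE y)" for x y :: cayley
    by (simp add: dist_norm norm_cayley minus_cayley_def)
  have "continuous_on S (\<lambda>x. jmat (f x) $ i $ j)" for i j
  proof -
    have "continuous_on S (\<lambda>x. (cH (jmat (f x) $ i $ j), cE (jmat (f x) $ i $ j)))"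
      by (intro continuous_on_Pair assms)
    then show ?thesis
      by (simp only: continuous_on_def tendsto_iff dist_cayley)
  qed
  then have "continuous_on S (\<lambda>x. \<chi> i j. jmat (f x) $ i $ j)"
    by (intro continuous_on_vec_lambda)
  then have "continuous_on S (\<lambda>x. jmat (f x))"
    by simp
  moreover have "dist X Y = dist (jmat X) (jmat Y)" for X Y
    by (simp add: dist_norm norm_jordan_def norm_eq_sqrt_inner inner_jordan.rep_eq
        minus_jordan.rep_eq)
  ultimately show ?thesis
    by (simp only: continuous_on_def tendsto_iff)
qed

lemma linear_skew_part: "linear skew_part"
  by (rule linearI) (simp_all add: skew_part_def vec_eq_iff)

lemma continuous_on_block_act: "continuous_on UNIV block_act"
\<comment> \<open>The function space carries the topology of pointwise convergence, so the argument
  \<open>X\<close> can be fixed first.\<close>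
proof (intro continuous_on_coordinatewise_then_product continuous_on_jordan)
  have block: "continuous_on UNIV (\<lambda>x :: (quat^1^1) \<times> (quat^1^1) \<times> (quat^2^2). block (fst (snd x)) (snd (snd x)))"
    unfolding block_def
  proof (intro continuous_on_vec_lambda)
    show "continuous_on UNIV (\<lambda>x :: (quat^1^1) \<times> (quat^1^1) \<times> (quat^2^2).
      if i = 1 then if j = 1 then fst (snd x) $ 1 $ 1 else 0 else if j = 1 then 0
      else snd (snd x) $ (if i = 2 then 1 else 2) $ (if j = 2 then 1 else 2))" for i j :: 3
      by (cases "i = 1"; cases "j = 1"; simp only: simp_thms if_True if_False; intro continuous_intros)
  qed
  have adj: "continuous_on UNIV (\<lambda>x. qmat_adj (f x))" if "continuous_on UNIV f"
    for f :: "(quat^1^1) \<times> (quat^1^1) \<times> (quat^2^2) \<Rightarrow> quat^3^3"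
    unfolding qmat_adj_def
    by (intro continuous_intros linear_continuous_on_compose[OF _ linear_qcnj] that)
  fix X i j
  have block_act: "block_act x = act (fst x) (block (fst (snd x)) (snd (snd x)))" for x
    by (simp add: block_act_def split_beta)
  have "continuous_on UNIV (\<lambda>x. mpart (block_act x X))"
    unfolding block_act mpart_act matrix_matrix_mult_def
    by (intro continuous_intros block adj)
  then show "continuous_on UNIV (\<lambda>x. cH (jmat (block_act x X) $ i $ j))"
    unfolding cH_jmat by (intro continuous_intros)
  have "continuous_on UNIV (\<lambda>x. vpart (block_act x X))"
    unfolding block_act vpart_act matrix_matrix_mult_def
    by (intro continuous_intros block adj)
  then have "continuous_on UNIV (\<lambda>x. skew_part (vpart (block_act x X)))"
    by (rule linear_continuous_on_compose[OF _ linear_skew_part])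
  then show "continuous_on UNIV (\<lambda>x. cE (jmat (block_act x X) $ i $ j))"
    unfolding cE_jmat by (intro continuous_intros)
qed

theorem theorem4p3p5:
  shows "topological_group_iso
    (Sp1_Sp1_Sp2 Mod Z2)
    (partition_topology (top_of_set (carrier Sp1_Sp1_Sp2)) (rcosets\<^bsub>Sp1_Sp1_Sp2\<^esub> Z2))
    (F4_group\<lparr>carrier := F4_gamma \<inter> F4_gamma_sigma\<rparr>)
    (top_of_set (F4_gamma \<inter> F4_gamma_sigma))"
proof -
  let ?G = "Sp1_Sp1_Sp2" and ?K = "F4_gamma \<inter> F4_gamma_sigma"
  let ?P = "rcosets\<^bsub>?G\<^esub> Z2"
  define F where "F = (\<lambda>c. the_elem (block_act ` c))"
  interpret hom: group_hom ?G "F4_group\<lparr>carrier := ?K\<rparr>" block_act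
    by (rule block_act_group_hom)
  have iso: "F \<in> iso (?G Mod Z2) (F4_group\<lparr>carrier := ?K\<rparr>)"
    using hom.FactGroup_iso_set block_act_image by (simp add: block_act_kernel F_def)
  have subgroup: "subgroup Z2 ?G"
    using hom.subgroup_kernel by (simp add: block_act_kernel)
  have bij: "bij_betw F ?P ?K"
    using iso by (simp add: iso_def FactGroup_def)
  \<comment> \<open>\<open>the_elem\<close> gives the intended value because
    \<open>block_act\<close> is constant on each coset of its kernel.\<close>
  have F: "F c = block_act x" if c: "c \<in> ?P" and x: "x \<in> c" for c x
  proof -
    obtain a where a: "a \<in> carrier ?G" and c_eq: "c = Z2 #>\<^bsub>?G\<^esub> a"
      using c by (auto simp only: RCOSETS_def UN_iff singleton_iff)
    have const: "block_act y = block_act a" if y: "y \<in> c" for y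
    proof -
      obtain z where z: "z \<in> Z2" "y = z \<otimes>\<^bsub>?G\<^esub> a"
        using y unfolding c_eq r_coset_def by blast
      then have "z \<in> carrier ?G" "block_act z = \<one>\<^bsub>F4_group\<lparr>carrier := ?K\<rparr>\<^esub>"
        using block_act_kernel by (auto simp only: kernel_def mem_Collect_eq)
      then show ?thesis
        using z a by (simp only: hom.hom_mult hom.hom_closed hom.H.l_one)
    qed
    show ?thesis
      unfolding F_def
    proof (rule the_elem_image_unique)
      show "c \<noteq> {}"
        using x by blast
      show "block_act y = block_act x" if "y \<in> c" for y
        using const[OF that] const[OF x] by (rule trans[OF _ sym])
    qed
  qed
  have disj: "disjoint ?P"
    using hom.G.rcos_disjoint[OF subgroup] by (simp add: disjoint_def pairwise_def disjnt_def)
  have union: "\<Union>?P = carrier ?G"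
    by (rule hom.G.rcosets_part_G[OF subgroup])
  have top: "topspace (partition_topology (top_of_set (carrier ?G)) ?P) = ?P"
  proof
    show "topspace (partition_topology (top_of_set (carrier ?G)) ?P) \<subseteq> ?P"
      using openin_topspace openin_partition_topology[OF disj] by blast
    have "openin (partition_topology (top_of_set (carrier ?G)) ?P) ?P"
      by (simp only: openin_partition_topology[OF disj] union) simp
    then show "?P \<subseteq> topspace (partition_topology (top_of_set (carrier ?G)) ?P)"
      by (rule openin_subset)
  qed
  have "quotient_map (top_of_set (carrier ?G)) (top_of_set ?K) block_act"
  proof (rule continuous_closed_imp_quotient_map)
    show cont: "continuous_map (top_of_set (carrier ?G)) (top_of_set ?K) block_act"
      using continuous_on_subset[OF continuous_on_block_act] block_act_image by auto
    have "compact (carrier ?G)"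
      by (simp add: Sp_group_def compact_Times compact_Sp)
    moreover have "Hausdorff_space (euclidean :: (jordan \<Rightarrow> jordan) topology)"
      by (simp add: Hausdorff_space_product_topology flip: euclidean_product_topology)
    ultimately show "closed_map (top_of_set (carrier ?G)) (top_of_set ?K) block_act"
      using cont by (intro continuous_imp_closed_map)
        (auto simp: compact_space_subtopology Hausdorff_space_subtopology)
  qed (use block_act_image in simp)
  then have open_iff: "openin (top_of_set (carrier ?G)) {x \<in> carrier ?G. block_act x \<in> U}
      \<longleftrightarrow> openin (top_of_set ?K) U" if "U \<subseteq> ?K" for U
    using that by (simp add: quotient_map_def)
  have "homeomorphic_map (partition_topology (top_of_set (carrier ?G)) ?P) (top_of_set ?K) F"
    unfolding homeomorphic_map_def quotient_map_def top
  proof (intro conjI allI impI)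
    show "F ` ?P = topspace (top_of_set ?K)" "inj_on F ?P"
      using bij by (auto simp: bij_betw_def)
    fix U assume "U \<subseteq> topspace (top_of_set ?K)"
    then have U: "U \<subseteq> ?K" by simp
    \<comment> \<open>The classes sent into \<open>U\<close> together fill the preimage of
      \<open>U\<close> under \<open>block_act\<close>, so openness in the partition topology becomes
      the quotient map property of \<open>block_act\<close>.\<close>
    have "\<Union>{c \<in> ?P. F c \<in> U} = {x \<in> carrier ?G. block_act x \<in> U}"
      unfolding union[symmetric] using F by fastforce
    then show "openin (partition_topology (top_of_set (carrier ?G)) ?P) {c \<in> ?P. F c \<in> U}
      \<longleftrightarrow> openin (top_of_set ?K) U"
      using open_iff[OF U] by (simp add: openin_partition_topology[OF disj])
  qed
  with iso show ?thesis
    unfolding topological_group_iso_def by blast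
qed

end
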